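(* Let $k$ be an algebraically closed field of characteristic zero. Let $d\geq 2$ be an integer and let $r$ be an integer such that $r=s^d$ for some integer $s\geq 2$. Suppose moreover that $(r,d)\notin\{(4,2),(9,2),(8,3)\}$. Then for all integers $\delta\ge 0$ and $\mu\geq 1$ with $\delta\leq s\mu$, one has $l(d,\delta,\mu^r)=0$; that is, for general points $p_1,\dots,p_r\in\mathbb{P}^d_k$, the only homogeneous polynomial of degree $\delta$ in $k[X_0,\dots,X_d]$ vanishing with order at least $\mu$ at each of $p_1,\dots,p_r$ is $0$.
   Context: For integers $d,\delta,\mu,r$, $l(d,\delta,\mu^r)$ denotes the dimension over $k$ of the vector space of homogeneous polynomials of degree $\delta$ in $k[X_0,\dots,X_d]$ that vanish with order at least $\mu$ at each of $r$ general points $p_1,\dots,p_r$ of $\mathbb{P}^d_k$. Here "general" means that $(p_1,\dots,p_r)$ lies in a suitable nonempty Zariski open subset (which may depend on $d,\delta,\mu,r$) of $(\mathbb{P}^d_k)^r$, on which this dimension takes its minimal (generic) value. *)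

theory Defs
  imports "HOL-Computational_Algebra.Computational_Algebra" "HOL-Library.Poly_Mapping"
    "HOL-Library.FuncSet"
begin

section \<open>Multivariate polynomials\<close>

text \<open>A polynomial is a finitely supported map from exponent vectors to coefficients; the
  product on this type is the convolution product.\<close>

type_synonym ('v, 'k) mpoly = "('v \<Rightarrow>\<^sub>0 nat) \<Rightarrow>\<^sub>0 'k"

definition mconst :: "'k :: comm_ring_1 \<Rightarrow> ('v, 'k) mpoly" where
  "mconst c = Poly_Mapping.single 0 c"

definition mvar :: "'v \<Rightarrow> ('v, 'k :: comm_ring_1) mpoly" where
  "mvar v = Poly_Mapping.single (Poly_Mapping.single v 1) 1"

definition mscale :: "'k :: field \<Rightarrow> ('v, 'k) mpoly \<Rightarrow> ('v, 'k) mpoly" where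
  "mscale c F = mconst c * F"

interpretation mpoly: vector_space mscale
  by unfold_locales
     (simp_all add: mscale_def mconst_def distrib_left distrib_right single_add mult_single
       flip: mult.assoc)

text \<open>The value of the polynomial at the point \<open>\<sigma>\<close> of a commutative ring, its coefficients being
  mapped into that ring by \<open>h\<close>.\<close>

definition msubst :: "('k :: comm_ring_1 \<Rightarrow> 'b :: comm_ring_1) \<Rightarrow> ('v \<Rightarrow> 'b) \<Rightarrow> ('v, 'k) mpoly \<Rightarrow> 'b" where
  "msubst h \<sigma> F =
     (\<Sum>m\<in>Poly_Mapping.keys F. h (Poly_Mapping.lookup F m) *
        (\<Prod>v\<in>Poly_Mapping.keys m. \<sigma> v ^ Poly_Mapping.lookup m v))"

abbreviation meval :: "('v \<Rightarrow> 'k) \<Rightarrow> ('v, 'k :: comm_ring_1) mpoly \<Rightarrow> 'k" where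
  "meval \<equiv> msubst (\<lambda>c. c)"

definition mdeg :: "('v \<Rightarrow>\<^sub>0 nat) \<Rightarrow> nat" where
  "mdeg m = (\<Sum>v\<in>Poly_Mapping.keys m. Poly_Mapping.lookup m v)"

text \<open>The space of homogeneous polynomials of degree \<open>\<delta>\<close> (together with \<open>0\<close>) in the variables
  \<open>X\<^sub>0, \<dots>, X\<^sub>d\<close>.\<close>

definition homogeneous_polys :: "nat \<Rightarrow> nat \<Rightarrow> (nat, 'k :: field) mpoly set" where
  "homogeneous_polys d \<delta> =
     {F. \<forall>m\<in>Poly_Mapping.keys F. Poly_Mapping.keys m \<subseteq> {..d} \<and> mdeg m = \<delta>}"

section \<open>Projective space and its powers\<close>

text \<open>Homogeneous coordinates \<open>(a\<^sub>0, \<dots>, a\<^sub>d)\<close> are functions on \<open>nat\<close> that are \<open>0\<close> beyond \<open>d\<close>.\<close>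

definition hom_coords :: "nat \<Rightarrow> (nat \<Rightarrow> 'k :: field) set" where
  "hom_coords d = {a. (\<forall>j>d. a j = 0) \<and> (\<exists>j\<le>d. a j \<noteq> 0)}"

definition proportional :: "nat \<Rightarrow> ((nat \<Rightarrow> 'k :: field) \<times> (nat \<Rightarrow> 'k)) set" where
  "proportional d = {(a, b) \<in> hom_coords d \<times> hom_coords d. \<exists>c. c \<noteq> 0 \<and> b = (\<lambda>j. c * a j)}"

definition proj_space :: "nat \<Rightarrow> (nat \<Rightarrow> 'k :: field) set set" where
  "proj_space d = hom_coords d // proportional d"

definition proj_power :: "nat \<Rightarrow> nat \<Rightarrow> (nat \<Rightarrow> (nat \<Rightarrow> 'k :: field) set) set" where
  "proj_power d r = ({..<r} \<rightarrow>\<^sub>E proj_space d)"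

text \<open>Multihomogeneous polynomials in the coordinates \<open>X\<^sub>i\<^sub>,\<^sub>j\<close> (\<open>i < r\<close>, \<open>j \<le> d\<close>), where \<open>e i\<close> is the
  degree in the \<open>i\<close>-th group of variables.  Their common zero loci are the Zariski closed
  subsets of the \<open>r\<close>-fold power of projective space.\<close>

definition multihomogeneous ::
  "nat \<Rightarrow> nat \<Rightarrow> (nat \<Rightarrow> nat) \<Rightarrow> (nat \<times> nat, 'k :: field) mpoly \<Rightarrow> bool" where
  "multihomogeneous d r e F \<longleftrightarrow>
     (\<forall>m\<in>Poly_Mapping.keys F. Poly_Mapping.keys m \<subseteq> {..<r} \<times> {..d} \<and>
        (\<forall>i<r. (\<Sum>j\<le>d. Poly_Mapping.lookup m (i, j)) = e i))"

definition zariski_closed :: "nat \<Rightarrow> nat \<Rightarrow> (nat \<Rightarrow> (nat \<Rightarrow> 'k :: field) set) set \<Rightarrow> bool" where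
  "zariski_closed d r Z \<longleftrightarrow>
     (\<exists>S. (\<forall>F\<in>S. \<exists>e. multihomogeneous d r e F) \<and>
          Z = {p \<in> proj_power d r.
                 \<forall>F\<in>S. \<forall>a. (\<forall>i<r. a i \<in> p i) \<longrightarrow> meval (\<lambda>(i, j). a i j) F = 0})"

definition zariski_open :: "nat \<Rightarrow> nat \<Rightarrow> (nat \<Rightarrow> (nat \<Rightarrow> 'k :: field) set) set \<Rightarrow> bool" where
  "zariski_open d r U \<longleftrightarrow> U \<subseteq> proj_power d r \<and> zariski_closed d r (proj_power d r - U)"

definition for_general_points ::
  "nat \<Rightarrow> nat \<Rightarrow> ((nat \<Rightarrow> (nat \<Rightarrow> 'k :: field) set) \<Rightarrow> bool) \<Rightarrow> bool" where
  "for_general_points d r P \<longleftrightarrow> (\<exists>U. zariski_open d r U \<and> U \<noteq> {} \<and> (\<forall>p\<in>U. P p))"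

section \<open>Vanishing order and the generic dimension\<close>

text \<open>Local equation of \<open>F = 0\<close> near the point with homogeneous coordinates \<open>a\<close>, where \<open>a i \<noteq> 0\<close>:
  dehomogenize by \<open>X\<^sub>i = 1\<close> and translate the point, which has affine coordinates \<open>a j / a i\<close>
  (\<open>j \<noteq> i\<close>), to the origin.\<close>

definition local_equation ::
  "nat \<Rightarrow> (nat \<Rightarrow> 'k :: field) \<Rightarrow> (nat, 'k) mpoly \<Rightarrow> (nat, 'k) mpoly" where
  "local_equation i a F =
     msubst mconst (\<lambda>j. if j = i then 1 else mconst (a j / a i) + mvar j) F"

text \<open>Vanishing to order at least \<open>\<mu>\<close> means that the local equation lies in the \<open>\<mu>\<close>-th power of the
  maximal ideal of the origin, i.e. has no term of degree less than \<open>\<mu>\<close>.  For homogeneous \<open>F\<close> this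
  depends neither on the chart nor on the representative; it is required in all of them.\<close>

definition vanishes_to_order ::
  "nat \<Rightarrow> nat \<Rightarrow> (nat \<Rightarrow> 'k :: field) set \<Rightarrow> (nat, 'k) mpoly \<Rightarrow> bool" where
  "vanishes_to_order d \<mu> p F \<longleftrightarrow>
     (\<forall>a\<in>p. \<forall>i\<le>d. a i \<noteq> 0 \<longrightarrow>
        (\<forall>m\<in>Poly_Mapping.keys (local_equation i a F). \<mu> \<le> mdeg m))"

definition fat_point_system ::
  "nat \<Rightarrow> nat \<Rightarrow> nat \<Rightarrow> nat \<Rightarrow> (nat \<Rightarrow> (nat \<Rightarrow> 'k :: field) set) \<Rightarrow> (nat, 'k) mpoly set" where
  "fat_point_system d \<delta> \<mu> r p =
     {F \<in> homogeneous_polys d \<delta>. \<forall>i<r. vanishes_to_order d \<mu> (p i) F}"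

text \<open>The dimension of the system at general points over the field \<open>'k\<close>.  The value is unique when
  \<open>'k\<close> is infinite, because any two nonempty open sets then meet.\<close>

definition generic_dim :: "'k :: field itself \<Rightarrow> nat \<Rightarrow> nat \<Rightarrow> nat \<Rightarrow> nat \<Rightarrow> nat" where
  "generic_dim (_ :: 'k itself) d \<delta> \<mu> r =
     (THE n. for_general_points d r
        (\<lambda>p. mpoly.dim (fat_point_system d \<delta> \<mu> r p :: (nat, 'k) mpoly set) = n))"

end

theory Submission
  imports Defs
begin

text \<open>
  In the chart \<open>X\<^sub>0 = 1\<close> let \<open>n = d - 1\<close>, \<open>y = (x\<^sub>1, \<dots>, x\<^sub>n)\<close> and \<open>z = x\<^sub>d\<close>.  The points are placed on the
  \<open>s^n\<close> lines parallel to the \<open>z\<close>-axis over the grid \<open>{0, \<dots>, s - 1}^n\<close>, with \<open>s\<close> points on each line.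

  Let \<open>F\<close> have degree at most \<open>s * \<mu>\<close> and vanish to order \<open>\<mu>\<close> at these points, and let \<open>h(z)\<close> be the
  coefficient of \<open>(y - \<kappa>)^g\<close> in \<open>F\<close> on the line over \<open>\<kappa>\<close>.  If all such coefficients with \<open>\<bar>g\<bar> < j < \<mu>\<close>
  vanish, then for \<open>\<bar>g\<bar> = j\<close> the degree of \<open>h\<close> is at most \<open>s * (\<mu> - j)\<close>, and \<open>h\<close> has zeros of order \<open>\<mu> - j\<close> at
  the points of the line.  So \<open>h\<close> is a multiple of a power of the polynomial with these points as
  roots.  Up to a nonzero factor depending on \<open>\<kappa>\<close> and \<open>g\<close>, the leading coefficient of \<open>h\<close> is the same for
  all lines, and the next one is an affine function of \<open>\<kappa>\<close> (\<open>leading_coefficients_on_grid\<close>).  Now let one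
  line carry its points at \<open>1, \<dots>, s\<close> and the others at \<open>0, \<dots>, s - 1\<close>.  Then the sum of the roots is not an
  affine function of \<open>\<kappa>\<close>, and since the characteristic is zero, \<open>h\<close> vanishes
  (\<open>top_coeffs_line_poly_zero\<close>).  This additive obstruction replaces the divisor class of infinite order on a
  curve in Nagata's proof for the plane.  It follows that \<open>F\<close> is a form of degree \<open>\<mu>\<close> with constant
  coefficients in the \<open>n\<close> polynomials \<open>f(x\<^sub>i) = x\<^sub>i * (x\<^sub>i - 1) * \<dots> * (x\<^sub>i - s + 1)\<close>.

  These forms exist, so the configuration is not general yet.  It becomes so to first order if \<open>n\<close>
  points on \<open>n\<close> further lines move, the \<open>i\<close>-th one in the direction of \<open>x\<^sub>i\<close>: for a family \<open>F + t * G + \<dots>\<close>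
  of solutions, the argument above, applied to \<open>G\<close> with one order less, shows that the derivative
  of \<open>F\<close> with respect to \<open>x\<^sub>i\<close> vanishes to order \<open>\<mu>\<close> at the \<open>i\<close>-th moving point, and then \<open>F = 0\<close>
  (\<open>first_order_rigidity\<close>).  The choice of the special lines needs \<open>n + 1\<close> points of the grid other than
  the origin and the unit vectors, that is \<open>2 * (n + 1) \<le> s^n\<close>.  This fails exactly in the three
  excluded cases.

  Consequently there is no nonzero solution over the polynomials in \<open>t\<close>.  Gaussian elimination turns
  this into a multihomogeneous polynomial in the coordinates of the points that is not identically zero on
  the moving configuration, and whose nonvanishing at any configuration forces the linear system to be
  zero (\<open>kernel_or_generic_injectivity\<close>, \<open>generic_vanishing_polynomial\<close>).  Its nonvanishing locus is the
  open set of general points.  Since this set meets every other nonempty open set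
  (\<open>nonvanishing_locus_meets_open\<close>), the generic dimension is well defined and equal to zero.
\<close>

section \<open>Polynomials in one variable\<close>

lemma pcompose_power:
  fixes p q :: "'k :: comm_semiring_1 poly"
  shows "pcompose (p ^ n) q = pcompose p q ^ n"
  by (induction n) (simp_all add: pcompose_1 pcompose_mult)

lemma pcompose_X: "pcompose [:0, 1:] q = (q :: 'k :: comm_semiring_1 poly)"
  by (simp add: pcompose_pCons)

lemma pcompose_linear_factor:
  "pcompose [:- a, 1:] [:a, 1:] = (monom 1 1 :: 'k :: comm_ring_1 poly)"
  by (simp add: pcompose_pCons monom_altdef)

lemma poly_eq_0_of_multiple_roots:
  fixes h :: "'k :: idom poly"
  assumes "finite R" "0 < q" "\<And>a. a \<in> R \<Longrightarrow> [:-a, 1:] ^ q dvd h"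
    and "\<And>e. card R * q \<le> e \<Longrightarrow> coeff h e = 0"
  shows "h = 0"
proof (rule ccontr)
  assume h: "h \<noteq> 0"
  have q: "q \<le> order a h" if "a \<in> R" for a
    using assms(3)[OF that] h by (simp add: order_divides)
  have R: "R \<subseteq> {x. poly h x = 0}"
    using q \<open>0 < q\<close> h by (fastforce simp: order_root)
  have "card R * q = (\<Sum>a\<in>R. q)" by simp
  also have "\<dots> \<le> (\<Sum>a\<in>R. order a h)" by (intro sum_mono q)
  also have "\<dots> \<le> (\<Sum>x | poly h x = 0. order x h)"
    using R h by (intro sum_mono2) (auto simp: poly_roots_finite)
  also have "\<dots> \<le> degree h" by (rule sum_order_le_degree[OF h])
  finally show False using assms(4)[of "degree h"] h by simp
qed

lemma translated_coeffs_zero_imp_power_dvd: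
  fixes h :: "'k :: idom poly"
  assumes "\<And>l. l < q \<Longrightarrow> coeff (pcompose h [:a, 1:]) l = 0"
  shows "[:-a, 1:] ^ q dvd h"
proof -
  let ?h = "pcompose h [:a, 1:]"
  have "monom 1 q dvd ?h"
    using assms by (simp add: monom_1_dvd_iff')
  then obtain w where w: "?h = monom 1 q * w" by blast
  have "h = pcompose ?h [:-a, 1:]"
    by (simp add: pcompose_pCons flip: pcompose_assoc)
  also have "\<dots> = [:-a, 1:] ^ q * pcompose w [:-a, 1:]"
    by (simp only: w pcompose_mult monom_altdef pcompose_smult pcompose_power pcompose_X) simp
  finally show ?thesis by simp
qed

text \<open>A translation changes the second highest coefficient by a multiple of the highest one, and the
  factor grows with the degree.  In characteristic zero this makes the shift of a root set visible
  in that coefficient.\<close>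

lemma coeff_pcompose_translation_below_top:
  fixes h :: "'k :: comm_ring_1 poly"
  assumes "degree h \<le> Suc n"
  shows "coeff (pcompose h [:b, 1:]) n = coeff h n + of_nat (Suc n) * b * coeff h (Suc n)"
proof -
  have d: "degree (pCons b 1 ^ i) \<le> i" for i
    by (rule order_trans[OF degree_power_le]) simp
  have "pcompose h [:b, 1:] = pcompose (\<Sum>i\<le>Suc n. monom (coeff h i) i) [:b, 1:]"
    using poly_as_sum_of_monoms'[OF assms] by simp
  also have "\<dots> = (\<Sum>i\<le>Suc n. smult (coeff h i) ([:b, 1:] ^ i))"
    unfolding pcompose_sum by (simp only: monom_altdef pcompose_smult pcompose_power pcompose_X)
  also have "coeff \<dots> n = (\<Sum>i\<in>{n, Suc n}. coeff h i * coeff ([:b, 1:] ^ i) n)"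
    unfolding coeff_sum coeff_smult
  proof (intro sum.mono_neutral_right ballI)
    fix i assume i: "i \<in> {..Suc n} - {n, Suc n}"
    then have "i < n" by auto
    then have "coeff ([:b, 1:] ^ i) n = 0"
      using d[of i] by (intro coeff_eq_0) (auto simp: one_pCons)
    then show "coeff h i * coeff ([:b, 1:] ^ i) n = 0" by simp
  qed auto
  finally show ?thesis
    by (simp add: coeff_linear_poly_power algebra_simps del: power_Suc)
qed

lemma coeff_translated_monom:
  fixes c a :: "'k :: comm_ring_1"
  shows "coeff (pcompose (monom c n) [:a, 1:]) g = c * (of_nat (n choose g) * a ^ (n - g))"
proof -
  have "pcompose (monom c n) [:a, 1:] = smult c ([:a, 1:] ^ n)"
    by (simp only: monom_altdef pcompose_smult pcompose_power pcompose_X)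
  moreover have "degree ([:a, 1:] ^ n) \<le> n"
    by (rule order_trans[OF degree_power_le]) simp
  ultimately show ?thesis
    by (cases "g \<le> n") (simp_all add: coeff_linear_poly_power binomial_eq_0 coeff_eq_0)
qed

definition grid_poly :: "nat \<Rightarrow> 'k :: comm_ring_1 poly" where
  "grid_poly s = (\<Prod>a<s. [:- of_nat a, 1:])"

lemma degree_grid_poly: "degree (grid_poly s :: 'k :: idom poly) = s"
  by (simp add: grid_poly_def degree_prod_sum_eq)

lemma lead_coeff_grid_poly: "lead_coeff (grid_poly s :: 'k :: idom poly) = 1"
  by (simp add: grid_poly_def lead_coeff_prod)

text \<open>The basis behind expansions in powers of \<open>grid_poly\<close>: one element for each degree, so degree
  bounds survive the change of basis, and each element vanishes to order \<open>k div s\<close> at all roots of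
  \<open>grid_poly\<close>.\<close>

definition adic_basis :: "nat \<Rightarrow> nat \<Rightarrow> 'k :: comm_ring_1 poly" where
  "adic_basis s k = grid_poly s ^ (k div s) * monom 1 (k mod s)"

lemma degree_adic_basis: "degree (adic_basis s k :: 'k :: idom poly) = k"
  and lead_coeff_adic_basis: "lead_coeff (adic_basis s k :: 'k poly) = 1"
proof -
  have g: "grid_poly s \<noteq> (0 :: 'k poly)"
    using lead_coeff_grid_poly[of s, where 'k='k] by auto
  show "degree (adic_basis s k :: 'k poly) = k"
    using g by (simp add: adic_basis_def degree_mult_eq degree_power_eq degree_grid_poly degree_monom_eq)
  show "lead_coeff (adic_basis s k :: 'k poly) = 1"
    unfolding adic_basis_def lead_coeff_mult lead_coeff_power lead_coeff_grid_poly
    by (simp add: degree_monom_eq)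
qed

lemma adic_expansion:
  fixes p :: "'k :: idom poly"
  shows "\<exists>c. p = (\<Sum>k\<le>degree p. smult (c k) (adic_basis s k))"
proof (induction "degree p" arbitrary: p rule: less_induct)
  case less
  define l where "l = lead_coeff p"
  define p' where "p' = p - smult l (adic_basis s (degree p))"
  have p: "p = p' + smult l (adic_basis s (degree p))" by (simp add: p'_def)
  show ?case
  proof (cases "p' = 0")
    case True
    then have "p = (\<Sum>k\<le>degree p. smult (if k = degree p then l else 0) (adic_basis s k))"
      using p by (simp add: if_distrib[of "\<lambda>c. smult c _"] cong: if_cong)
    then show ?thesis by (rule exI[of "\<lambda>c. p = (\<Sum>k\<le>degree p. smult (c k) (adic_basis s k))"])
  next
    case False
    have "degree p' \<le> degree p"
      unfolding p'_def
      by (rule degree_diff_le) (auto intro: order_trans[OF degree_smult_le] simp: degree_adic_basis)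
    moreover have "coeff p' (degree p) = 0"
      using lead_coeff_adic_basis[of s "degree p", where 'k='k]
      by (simp add: p'_def l_def degree_adic_basis)
    ultimately have lt: "degree p' < degree p"
      using False leading_coeff_0_iff[of p'] by (cases "degree p' = degree p") auto
    from less[OF lt] obtain c where c: "p' = (\<Sum>k\<le>degree p'. smult (c k) (adic_basis s k))"
      by blast
    let ?c = "\<lambda>k. (if k \<le> degree p' then c k else 0) + (if k = degree p then l else 0)"
    have "p' = (\<Sum>k\<le>degree p. smult (if k \<le> degree p' then c k else 0) (adic_basis s k))"
      by (subst c, rule sum.mono_neutral_cong_left) (use lt in auto)
    then have "p = (\<Sum>k\<le>degree p. smult (?c k) (adic_basis s k))"
      using p by (simp add: smult_add_left sum.distrib if_distrib[of "\<lambda>c. smult c _"] cong: if_cong)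
    then show ?thesis by (rule exI[of "\<lambda>c. p = (\<Sum>k\<le>degree p. smult (c k) (adic_basis s k))"])
  qed
qed

text \<open>The derivative of \<open>grid_poly s\<close> at its root \<open>\<kappa>\<close>.\<close>

definition grid_slope :: "nat \<Rightarrow> nat \<Rightarrow> 'k :: comm_ring_1" where
  "grid_slope s \<kappa> = (\<Prod>a\<in>{..<s} - {\<kappa>}. of_nat \<kappa> - of_nat a)"

lemma grid_slope_nonzero: "(grid_slope s \<kappa> :: 'k :: {idom, ring_char_0}) \<noteq> 0"
  by (auto simp: grid_slope_def)

lemma coeff_translated_adic_basis:
  assumes "\<kappa> < s"
  shows "g < k div s \<Longrightarrow> coeff (pcompose (adic_basis s k) [:of_nat \<kappa>, 1:]) g = (0 :: 'k :: comm_ring_1)"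
    and "coeff (pcompose (adic_basis s k) [:of_nat \<kappa>, 1:]) (k div s) =
          grid_slope s \<kappa> ^ (k div s) * (of_nat \<kappa> ^ (k mod s) :: 'k)"
proof -
  let ?r = "\<Prod>a\<in>{..<s} - {\<kappa>}. [:- of_nat a, 1:] :: 'k poly"
  let ?T = "\<lambda>p. pcompose p [:of_nat \<kappa>, 1:] :: 'k poly"
  have g: "grid_poly s = [:- of_nat \<kappa>, 1:] * ?r"
    unfolding grid_poly_def using assms by (subst prod.remove[of _ \<kappa>]) auto
  have "?T (grid_poly s) = monom 1 1 * ?T ?r"
    by (simp only: g pcompose_mult pcompose_linear_factor)
  then have e: "?T (adic_basis s k) =
      monom 1 (k div s) * (?T ?r ^ (k div s) * ?T (monom 1 (k mod s)))"
    by (simp only: adic_basis_def pcompose_mult pcompose_power power_mult_distrib monom_power mult.assoc)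
       simp
  have m: "poly (monom 1 n) (of_nat \<kappa>) = (of_nat \<kappa> ^ n :: 'k)" for n
    by (simp add: poly_monom)
  show "g < k div s \<Longrightarrow> coeff (?T (adic_basis s k)) g = 0"
    unfolding e by (simp add: coeff_monom_mult)
  show "coeff (?T (adic_basis s k)) (k div s) =
          grid_slope s \<kappa> ^ (k div s) * (of_nat \<kappa> ^ (k mod s) :: 'k)"
    unfolding e
    by (simp add: coeff_monom_mult flip: poly_0_coeff_0)
       (simp add: poly_pcompose poly_prod grid_slope_def m)
qed

text \<open>The change of basis, stated for Taylor coefficients rather than polynomials because in several
  variables only products of these numbers occur.  The bound \<open>N\<close> is free so that one range of
  summation serves all monomials of a polynomial.\<close>

lemma adic_coefficients:
  obtains C :: "nat \<Rightarrow> nat \<Rightarrow> 'k :: idom"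
  where "\<And>m g \<kappa> N. m \<le> N \<Longrightarrow> of_nat (m choose g) * of_nat \<kappa> ^ (m - g) =
      (\<Sum>k\<le>N. C m k * coeff (pcompose (adic_basis s k) [:of_nat \<kappa>, 1:]) g)"
    and "\<And>m k. m < k \<Longrightarrow> C m k = 0"
proof -
  have "\<forall>m. \<exists>c. monom (1::'k) m = (\<Sum>k\<le>m. smult (c k) (adic_basis s k))"
    using adic_expansion[of "monom (1::'k) m" s for m] by (auto simp: degree_monom_eq)
  then obtain c where c: "\<And>m. monom (1::'k) m = (\<Sum>k\<le>m. smult (c m k) (adic_basis s k))"
    by metis
  define C where "C m k = (if k \<le> m then c m k else 0)" for m k
  show ?thesis
  proof
    fix m g \<kappa> N :: nat assume mN: "m \<le> N"
    have "monom (1::'k) m = (\<Sum>k\<le>N. smult (C m k) (adic_basis s k))"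
      by (subst c, rule sum.mono_neutral_cong_left) (use mN in \<open>auto simp: C_def\<close>)
    then have "of_nat (m choose g) * of_nat \<kappa> ^ (m - g) =
        coeff (pcompose (\<Sum>k\<le>N. smult (C m k) (adic_basis s k)) [:of_nat \<kappa>, 1:]) g"
      using coeff_translated_monom[of "1::'k" m "of_nat \<kappa>" g] by simp
    then show "of_nat (m choose g) * of_nat \<kappa> ^ (m - g) =
      (\<Sum>k\<le>N. C m k * coeff (pcompose (adic_basis s k) [:of_nat \<kappa>, 1:]) g)"
      by (simp only: pcompose_sum pcompose_smult coeff_sum coeff_smult)
  qed (simp add: C_def)
qed

text \<open>By its degree, \<open>h\<close> must be a constant multiple of the \<open>q\<close>-th power of the polynomial with the
  roots \<open>b, b + 1, \<dots>, b + s - 1\<close>.  So its two highest coefficients determine \<open>b\<close>, unless both vanish.\<close>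

lemma subleading_coeff_of_multiple_of_grid_power:
  fixes h :: "'k :: field_char_0 poly"
  assumes q: "0 < q" and s: "0 < s"
    and h: "\<And>l. s * q < l \<Longrightarrow> coeff h l = 0"
    and dvd: "\<And>a. a < s \<Longrightarrow> [:- (of_nat a + b), 1:] ^ q dvd h"
  shows "coeff h (s * q - 1) =
    coeff h (s * q) * (coeff (grid_poly s ^ q) (s * q - 1) - of_nat (s * q) * b)"
proof -
  define P where "P = (grid_poly s ^ q :: 'k poly)"
  define P' where "P' = pcompose P [:-b, 1:]"
  have "grid_poly s \<noteq> (0 :: 'k poly)"
    using lead_coeff_grid_poly[of s, where 'k='k] by auto
  then have P: "degree P = s * q"
    by (simp add: P_def degree_grid_poly degree_power_eq mult.commute)
  moreover have "lead_coeff P = 1"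
    by (simp only: P_def lead_coeff_power lead_coeff_grid_poly power_one)
  ultimately have Pc: "coeff P (s * q) = 1" by simp
  have P': "degree P' = s * q" "coeff P' (s * q) = 1"
    using P Pc lead_coeff_comp[of "[:-b, 1:]" P] by (simp_all add: P'_def degree_pcompose)
  have dvd': "[:- (of_nat a + b), 1:] ^ q dvd P'" if "a < s" for a
  proof -
    have "[:- of_nat a, 1:] dvd (grid_poly s :: 'k poly)"
      unfolding grid_poly_def using that by (intro dvd_prodI) auto
    then obtain w where "(grid_poly s :: 'k poly) = [:- of_nat a, 1:] * w" by blast
    then have "P' = pcompose [:- of_nat a, 1:] [:-b, 1:] ^ q * pcompose (w ^ q) [:-b, 1:]"
      by (simp only: P'_def P_def power_mult_distrib pcompose_mult pcompose_power)
    also have "pcompose [:- of_nat a, 1:] [:-b, 1:] = [:- (of_nat a + b), 1:]"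
      by (simp add: pcompose_pCons)
    finally show ?thesis by (rule dvdI)
  qed
  have "h - smult (coeff h (s * q)) P' = 0"
  proof (rule poly_eq_0_of_multiple_roots[of "(\<lambda>a. of_nat a + b) ` {..<s}" q])
    have card: "card ((\<lambda>a. of_nat a + b) ` {..<s}) = s"
      by (subst card_image) (auto simp: inj_on_def)
    show "coeff (h - smult (coeff h (s * q)) P') l = 0"
      if "card ((\<lambda>a. of_nat a + b) ` {..<s}) * q \<le> l" for l
    proof (cases "l = s * q")
      case True then show ?thesis using P' by simp
    next
      case False
      then have "s * q < l" using that card by simp
      then show ?thesis using h P' by (simp add: coeff_eq_0)
    qed
  qed (use q dvd dvd' in \<open>auto intro!: dvd_diff dvd_smult\<close>)
  then have "coeff h (s * q - 1) = coeff h (s * q) * coeff P' (s * q - 1)"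
    by (metis coeff_smult eq_iff_diff_eq_0)
  also have "coeff P' (s * q - 1) = coeff P (s * q - 1) - of_nat (s * q) * b"
    using coeff_pcompose_translation_below_top[of P "s * q - 1" "-b"] P Pc q s
    by (simp add: P'_def)
  finally show ?thesis by (simp add: P_def)
qed

text \<open>The entries are the coefficients of the Lagrange polynomials for the nodes \<open>0, \<dots>, s - 1\<close>.\<close>

lemma inverse_vandermonde:
  obtains L :: "nat \<Rightarrow> nat \<Rightarrow> 'k :: field_char_0"
  where "\<And>b c. b < s \<Longrightarrow> c < s \<Longrightarrow> (\<Sum>\<kappa><s. L b \<kappa> * of_nat \<kappa> ^ c) = (if b = c then 1 else 0)"
proof -
  define l where "l \<kappa> = smult (inverse (grid_slope s \<kappa>)) (\<Prod>a\<in>{..<s} - {\<kappa>}. [:- of_nat a, 1:] :: 'k poly)" for \<kappa>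
  have dl: "degree (l \<kappa>) < s" if "\<kappa> < s" for \<kappa>
  proof -
    have "degree (l \<kappa>) \<le> s - 1"
      unfolding l_def using that
      by (intro order_trans[OF degree_smult_le]) (simp add: degree_prod_sum_eq)
    with that show ?thesis by linarith
  qed
  have pl: "poly (l \<kappa>) (of_nat x) = (if \<kappa> = x then 1 else 0)" if "\<kappa> < s" "x < s" for \<kappa> x
    using that grid_slope_nonzero[of s \<kappa>, where 'k='k]
    by (auto simp: l_def poly_prod grid_slope_def)
  show ?thesis
  proof
    fix b c assume b: "b < s" and c: "c < s"
    define h where "h = (\<Sum>\<kappa><s. smult (of_nat \<kappa> ^ c) (l \<kappa>)) - monom 1 c"
    have "h = 0"
    proof (rule poly_eq_0_of_multiple_roots[of "of_nat ` {..<s}" 1])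
      show "[:-a, 1:] ^ 1 dvd h" if "a \<in> of_nat ` {..<s}" for a
      proof -
        from that obtain x where x: "x < s" "a = of_nat x" by auto
        have "(\<Sum>\<kappa><s. of_nat \<kappa> ^ c * poly (l \<kappa>) (of_nat x)) = (\<Sum>\<kappa><s. if \<kappa> = x then of_nat x ^ c else 0)"
          using x by (intro sum.cong) (auto simp: pl)
        then have "poly h a = 0" using x
          by (simp add: h_def poly_sum poly_monom)
        then show ?thesis by (simp add: poly_eq_0_iff_dvd)
      qed
      have "card (of_nat ` {..<s} :: 'k set) = s"
        by (subst card_image) (auto simp: inj_on_def)
      then show "coeff h e = 0" if "card (of_nat ` {..<s} :: 'k set) * 1 \<le> e" for e
      proof -
        from that \<open>card _ = s\<close> have "s \<le> e" by simp
        then have "coeff (l \<kappa>) e = 0" if "\<kappa> < s" for \<kappa>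
          using dl[OF that] by (intro coeff_eq_0) auto
        then show ?thesis using c \<open>s \<le> e\<close> by (simp add: h_def coeff_sum)
      qed
    qed auto
    then have "coeff (\<Sum>\<kappa><s. smult (of_nat \<kappa> ^ c) (l \<kappa>)) b = coeff (monom 1 c) b"
      by (simp add: h_def)
    then show "(\<Sum>\<kappa><s. coeff (l \<kappa>) b * of_nat \<kappa> ^ c) = (if b = c then 1 else 0)"
      by (simp add: coeff_sum mult.commute eq_commute)
  qed
qed

section \<open>Polynomials vanishing on a grid\<close>

text \<open>The coefficient of \<open>u\<^sup>g\<close> in the expansion of the monomial with exponents \<open>e\<close> at \<open>c + u\<close>.  Exponents
  and points are plain functions, of which only the values on \<open>Y\<close> matter.\<close>

definition hasse_monomial ::
  "'v set \<Rightarrow> ('v \<Rightarrow> nat) \<Rightarrow> ('v \<Rightarrow> nat) \<Rightarrow> ('v \<Rightarrow> 'k :: comm_semiring_1) \<Rightarrow> 'k" where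
  "hasse_monomial Y e g c = (\<Prod>i\<in>Y. of_nat (e i choose g i) * c i ^ (e i - g i))"

abbreviation grid :: "'v set \<Rightarrow> nat \<Rightarrow> ('v \<Rightarrow> nat) set" where
  "grid Y s \<equiv> PiE Y (\<lambda>_. {..<s})"

lemma hasse_monomial_cong:
  assumes "\<And>i. i \<in> Y \<Longrightarrow> e i = e' i" "\<And>i. i \<in> Y \<Longrightarrow> g i = g' i" "\<And>i. i \<in> Y \<Longrightarrow> c i = c' i"
  shows "hasse_monomial Y e g c = hasse_monomial Y e' g' c'"
  unfolding hasse_monomial_def using assms by (intro prod.cong) auto

text \<open>Products of rows of the inverse Vandermonde matrix are functionals of the values on the grid which are
  dual to the monomials of degree less than \<open>s\<close> in each variable.  The exponent
  vectors \<open>b k\<close> are indexed by an arbitrary set, which will consist of basis elements with the same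
  quotients modulo \<open>s\<close>.\<close>

lemma reduced_zero_on_grid:
  fixes w :: "('v \<Rightarrow> nat) \<Rightarrow> 'k :: field_char_0"
  assumes Y: "finite Y" and K: "finite K"
    and inj: "\<And>k k'. k \<in> K \<Longrightarrow> k' \<in> K \<Longrightarrow> (\<forall>i\<in>Y. b k i = b k' i) \<Longrightarrow> k = k'"
    and lt: "\<And>k i. k \<in> K \<Longrightarrow> i \<in> Y \<Longrightarrow> b k i < s"
    and zero: "\<And>\<kappa>. \<kappa> \<in> grid Y s \<Longrightarrow> (\<Sum>k\<in>K. w k * (\<Prod>i\<in>Y. of_nat (\<kappa> i) ^ b k i)) = 0"
    and k0: "k0 \<in> K"
  shows "w k0 = 0"
proof -
  obtain L :: "nat \<Rightarrow> nat \<Rightarrow> 'k" where L: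
    "\<And>b c. b < s \<Longrightarrow> c < s \<Longrightarrow> (\<Sum>\<kappa><s. L b \<kappa> * of_nat \<kappa> ^ c) = (if b = c then 1 else 0)"
    using inverse_vandermonde by blast
  have dual: "(\<Sum>\<kappa>\<in>grid Y s. (\<Prod>i\<in>Y. L (b k0 i) (\<kappa> i)) * (\<Prod>i\<in>Y. of_nat (\<kappa> i) ^ b k i)) =
      (if k = k0 then 1 else 0)" if k: "k \<in> K" for k
  proof -
    have "(\<Sum>\<kappa>\<in>grid Y s. (\<Prod>i\<in>Y. L (b k0 i) (\<kappa> i)) * (\<Prod>i\<in>Y. of_nat (\<kappa> i) ^ b k i)) =
        (\<Prod>i\<in>Y. \<Sum>\<kappa><s. L (b k0 i) \<kappa> * of_nat \<kappa> ^ b k i)"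
      using Y by (subst prod_sum_PiE) (auto simp: prod.distrib)
    also have "\<dots> = (\<Prod>i\<in>Y. if b k0 i = b k i then 1 else 0)"
      using lt[OF k] lt[OF k0] by (intro prod.cong refl L) auto
    also have "\<dots> = (if k = k0 then 1 else 0)"
    proof (cases "k = k0")
      case False
      then obtain i where "i \<in> Y" "b k0 i \<noteq> b k i" using inj[OF k0 k] by blast
      then have "\<exists>i\<in>Y. (if b k0 i = b k i then 1 else 0 :: 'k) = 0" by auto
      then show ?thesis using Y False by (simp only: prod_zero if_False)
    qed simp
    finally show ?thesis .
  qed
  have "w k0 = (\<Sum>k\<in>K. w k * (if k = k0 then 1 else 0))"
    using K k0 by (simp add: if_distrib cong: if_cong)
  also have "\<dots> = (\<Sum>k\<in>K. w k * (\<Sum>\<kappa>\<in>grid Y s.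
      (\<Prod>i\<in>Y. L (b k0 i) (\<kappa> i)) * (\<Prod>i\<in>Y. of_nat (\<kappa> i) ^ b k i)))"
    by (intro sum.cong refl arg_cong2[where f="(*)"]) (simp only: dual)
  also have "\<dots> = (\<Sum>\<kappa>\<in>grid Y s. (\<Prod>i\<in>Y. L (b k0 i) (\<kappa> i)) *
      (\<Sum>k\<in>K. w k * (\<Prod>i\<in>Y. of_nat (\<kappa> i) ^ b k i)))"
    by (simp add: sum_distrib_left sum.swap[of _ K] mult_ac)
  also have "\<dots> = 0" by (simp add: zero)
  finally show ?thesis .
qed

text \<open>Let \<open>f\<^sub>i = grid_poly s\<close> in the \<open>i\<close>-th variable.  A polynomial vanishing to order \<open>j\<close> on the grid is a
  combination of products \<open>f\<^sup>h y\<^sup>b\<close> with \<open>\<bar>h\<bar> \<ge> j\<close> and all \<open>b\<^sub>i < s\<close>.  Near the point \<open>\<kappa>\<close> of the grid, \<open>f\<^sub>i\<close> is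
  \<open>grid_slope s (\<kappa> i)\<close> times the local coordinate, up to higher order.  So the coefficient of \<open>u\<^sup>g\<close> with
  \<open>\<bar>g\<bar> = j\<close> only sees the terms with \<open>h = g\<close>, and the degree leaves no more than an affine function of
  \<open>\<kappa>\<close> as their cofactor.\<close>

lemma leading_coefficients_on_grid:
  fixes x :: "'m \<Rightarrow> 'k :: field_char_0" and e :: "'m \<Rightarrow> 'v \<Rightarrow> nat"
  assumes Y: "finite Y" and J: "finite J" and s: "2 \<le> s"
    and deg: "\<And>m. m \<in> J \<Longrightarrow> (\<Sum>i\<in>Y. e m i) \<le> D" and D: "D \<le> s * j + 1"
    and vanish: "\<And>\<kappa> g. \<kappa> \<in> grid Y s \<Longrightarrow> (\<Sum>i\<in>Y. g i) < j \<Longrightarrow>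
      (\<Sum>m\<in>J. x m * hasse_monomial Y (e m) g (\<lambda>i. of_nat (\<kappa> i))) = 0"
    and g: "(\<Sum>i\<in>Y. g i) = j"
  shows "\<exists>A0 A. (\<forall>\<kappa>\<in>grid Y s.
        (\<Sum>m\<in>J. x m * hasse_monomial Y (e m) g (\<lambda>i. of_nat (\<kappa> i))) =
        (\<Prod>i\<in>Y. grid_slope s (\<kappa> i) ^ g i) * (A0 + (\<Sum>i\<in>Y. A i * of_nat (\<kappa> i)))) \<and>
      (D \<le> s * j \<longrightarrow> (\<forall>i\<in>Y. A i = 0)) \<and> (D < s * j \<longrightarrow> A0 = 0)"
proof -
  obtain C :: "nat \<Rightarrow> nat \<Rightarrow> 'k" where
    C: "\<And>m g \<kappa> N. m \<le> N \<Longrightarrow> of_nat (m choose g) * of_nat \<kappa> ^ (m - g) =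
      (\<Sum>k\<le>N. C m k * coeff (pcompose (adic_basis s k) [:of_nat \<kappa>, 1:]) g)" and
    C0: "\<And>m k. m < k \<Longrightarrow> C m k = 0"
    using adic_coefficients by blast
  define T :: "nat \<Rightarrow> nat \<Rightarrow> nat \<Rightarrow> 'k"
    where "T k g \<kappa> = coeff (pcompose (adic_basis s k) [:of_nat \<kappa>, 1:]) g" for k g \<kappa>
  define K where "K = (PiE Y (\<lambda>_. {..D}) :: ('v \<Rightarrow> nat) set)"
  define w where "w k = (\<Sum>m\<in>J. x m * (\<Prod>i\<in>Y. C (e m i) (k i)))" for k
  have K: "finite K" using Y by (auto simp: K_def intro!: finite_PiE)
  have eD: "e m i \<le> D" if "m \<in> J" "i \<in> Y" for m i
    using member_le_sum[of i Y "e m"] deg[OF that(1)] that Y by simp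
  have w0: "w k = 0" if big: "D < (\<Sum>i\<in>Y. k i)" for k
  proof -
    have "(\<Prod>i\<in>Y. C (e m i) (k i)) = 0" if m: "m \<in> J" for m
    proof -
      have "\<exists>i\<in>Y. e m i < k i"
      proof (rule ccontr)
        assume "\<not> ?thesis"
        then have "(\<Sum>i\<in>Y. k i) \<le> (\<Sum>i\<in>Y. e m i)" by (intro sum_mono) (auto simp: not_less)
        then show False using deg[OF m] big by linarith
      qed
      then show ?thesis using Y C0 by (intro prod_zero) auto
    qed
    then show ?thesis by (simp add: w_def)
  qed
  have expand: "(\<Sum>m\<in>J. x m * hasse_monomial Y (e m) h (\<lambda>i. of_nat (\<kappa> i))) =
      (\<Sum>k\<in>K. w k * (\<Prod>i\<in>Y. T (k i) (h i) (\<kappa> i)))" for h \<kappa>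
  proof -
    have "hasse_monomial Y (e m) h (\<lambda>i. of_nat (\<kappa> i)) =
        (\<Sum>k\<in>K. (\<Prod>i\<in>Y. C (e m i) (k i)) * (\<Prod>i\<in>Y. T (k i) (h i) (\<kappa> i)))" if m: "m \<in> J" for m
    proof -
      have "hasse_monomial Y (e m) h (\<lambda>i. of_nat (\<kappa> i)) =
          (\<Prod>i\<in>Y. \<Sum>k\<le>D. C (e m i) k * T k (h i) (\<kappa> i))"
        unfolding hasse_monomial_def T_def using eD[OF m] by (intro prod.cong C) auto
      then show ?thesis
        using Y by (simp add: prod_sum_PiE K_def prod.distrib)
    qed
    then have "(\<Sum>m\<in>J. x m * hasse_monomial Y (e m) h (\<lambda>i. of_nat (\<kappa> i))) =
      (\<Sum>m\<in>J. x m * (\<Sum>k\<in>K. (\<Prod>i\<in>Y. C (e m i) (k i)) * (\<Prod>i\<in>Y. T (k i) (h i) (\<kappa> i))))"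
      by (intro sum.cong) auto
    also have "\<dots> = (\<Sum>k\<in>K. w k * (\<Prod>i\<in>Y. T (k i) (h i) (\<kappa> i)))"
      unfolding w_def sum_distrib_left sum_distrib_right
      by (subst sum.swap) (simp add: mult_ac)
    finally show ?thesis .
  qed
  \<comment> \<open>A basis element contributes only if all its quotients are at most \<open>h\<close>;
    those of smaller total are absent, which leaves the quotients \<open>h\<close>.\<close>
  have leading: "(\<Sum>k\<in>K. w k * (\<Prod>i\<in>Y. T (k i) (h i) (\<kappa> i))) =
      (\<Prod>i\<in>Y. grid_slope s (\<kappa> i) ^ h i) *
      (\<Sum>k\<in>{k\<in>K. \<forall>i\<in>Y. k i div s = h i}. w k * (\<Prod>i\<in>Y. of_nat (\<kappa> i) ^ (k i mod s)))"
    if \<kappa>: "\<kappa> \<in> grid Y s"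
      and low: "\<And>k. k \<in> K \<Longrightarrow> (\<Sum>i\<in>Y. k i div s) < (\<Sum>i\<in>Y. h i) \<Longrightarrow> w k = 0" for h \<kappa>
  proof -
    have "(\<Sum>k\<in>K. w k * (\<Prod>i\<in>Y. T (k i) (h i) (\<kappa> i))) =
        (\<Sum>k\<in>{k\<in>K. \<forall>i\<in>Y. k i div s = h i}. w k * (\<Prod>i\<in>Y. T (k i) (h i) (\<kappa> i)))"
    proof (intro sum.mono_neutral_right[OF K] ballI)
      fix k assume "k \<in> K - {k\<in>K. \<forall>i\<in>Y. k i div s = h i}"
      then obtain i where k: "k \<in> K" "i \<in> Y" "k i div s \<noteq> h i" by blast
      have "\<exists>l\<in>Y. h l < k l div s" if w: "w k \<noteq> 0"
      proof (rule ccontr)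
        assume "\<not> ?thesis"
        then have le: "\<And>l. l \<in> Y \<Longrightarrow> k l div s \<le> h l" by (auto simp: not_less)
        then have "(\<Sum>i\<in>Y. k i div s) < (\<Sum>i\<in>Y. h i)"
          using k Y by (intro sum_strict_mono_ex1) (auto intro!: bexI[of _ i] simp: less_le)
        then show False using low[OF k(1)] w by simp
      qed
      moreover have "T (k l) (h l) (\<kappa> l) = 0" if "l \<in> Y" "h l < k l div s" for l
        using \<kappa> that by (auto simp: T_def PiE_iff intro!: coeff_translated_adic_basis(1))
      ultimately show "w k * (\<Prod>i\<in>Y. T (k i) (h i) (\<kappa> i)) = 0"
        using Y by (cases "w k = 0") (auto intro!: prod_zero)
    qed auto
    also have "\<dots> = (\<Sum>k\<in>{k\<in>K. \<forall>i\<in>Y. k i div s = h i}. w k *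
        ((\<Prod>i\<in>Y. grid_slope s (\<kappa> i) ^ h i) * (\<Prod>i\<in>Y. of_nat (\<kappa> i) ^ (k i mod s))))"
    proof (intro sum.cong refl arg_cong2[where f="(*)"])
      fix k assume k: "k \<in> {k\<in>K. \<forall>i\<in>Y. k i div s = h i}"
      have "T (k i) (h i) (\<kappa> i) = grid_slope s (\<kappa> i) ^ h i * of_nat (\<kappa> i) ^ (k i mod s)"
        if "i \<in> Y" for i
        using coeff_translated_adic_basis(2)[of "\<kappa> i" s "k i", where 'k='k] k \<kappa> that
        by (auto simp: T_def PiE_iff)
      then show "(\<Prod>i\<in>Y. T (k i) (h i) (\<kappa> i)) =
          (\<Prod>i\<in>Y. grid_slope s (\<kappa> i) ^ h i) * (\<Prod>i\<in>Y. of_nat (\<kappa> i) ^ (k i mod s))"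
        by (simp add: prod.distrib)
    qed
    finally show ?thesis
      by (simp add: sum_distrib_left mult_ac)
  qed
  have slope: "(\<Prod>i\<in>Y. grid_slope s (\<kappa> i) ^ h i) \<noteq> (0::'k)" for h \<kappa>
    using Y by (simp add: grid_slope_nonzero)
  have low: "w k = 0" if "k \<in> K" "(\<Sum>i\<in>Y. k i div s) < j" for k
    using that
  proof (induction "\<Sum>i\<in>Y. k i div s" arbitrary: k rule: less_induct)
    case less
    let ?K = "{k'\<in>K. \<forall>i\<in>Y. k' i div s = k i div s}"
    show ?case
    proof (rule reduced_zero_on_grid[where K="?K" and w=w and b="\<lambda>k i. k i mod s" and s=s])
      show "k1 = k2" if k1: "k1 \<in> ?K" and k2: "k2 \<in> ?K"
        and mods: "\<forall>i\<in>Y. k1 i mod s = k2 i mod s" for k1 k2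
      proof (rule PiE_ext)
        show "k1 \<in> PiE Y (\<lambda>_. {..D})" using k1 unfolding K_def by blast
        show "k2 \<in> PiE Y (\<lambda>_. {..D})" using k2 unfolding K_def by blast
        show "k1 i = k2 i" if i: "i \<in> Y" for i
        proof -
          have "k1 i div s = k2 i div s" using k1 k2 i by simp
          moreover have "k1 i mod s = k2 i mod s" using mods i by blast
          ultimately show ?thesis by (metis div_mult_mod_eq)
        qed
      qed
      show "(\<Sum>k'\<in>?K. w k' * (\<Prod>i\<in>Y. of_nat (\<kappa> i) ^ (k' i mod s))) = 0"
        if \<kappa>: "\<kappa> \<in> grid Y s" for \<kappa>
      proof -
        have "(\<Prod>i\<in>Y. grid_slope s (\<kappa> i) ^ (k i div s)) *
          (\<Sum>k'\<in>?K. w k' * (\<Prod>i\<in>Y. of_nat (\<kappa> i) ^ (k' i mod s))) = 0"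
        proof -
          have "w k' = 0" if "k' \<in> K" "(\<Sum>i\<in>Y. k' i div s) < (\<Sum>i\<in>Y. k i div s)" for k'
            using less.hyps[OF that(2,1)] that(2) less.prems(2) by simp
          from leading[OF \<kappa> this] show ?thesis
            using expand[of "\<lambda>i. k i div s" \<kappa>] vanish[OF \<kappa> less.prems(2)] by simp
        qed
        then show ?thesis using slope by simp
      qed
    qed (use Y K less.prems s in auto)
  qed
  let ?K = "{k\<in>K. \<forall>i\<in>Y. k i div s = g i}"
  define k0 where "k0 = restrict (\<lambda>i. s * g i) Y"
  define kk where "kk i = k0(i := Suc (s * g i))" for i
  \<comment> \<open>The remainders of a surviving \<open>k\<close> add up to at most one.\<close>
  have split: "k = k0 \<or> (\<exists>i\<in>Y. k = kk i)" if k: "k \<in> ?K" "w k \<noteq> 0" for k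
  proof -
    have ki: "k i = s * g i + k i mod s" if "i \<in> Y" for i
    proof -
      have "k i div s = g i" using k that by blast
      then show ?thesis using mult_div_mod_eq[of s "k i"] by simp
    qed
    have "(\<Sum>i\<in>Y. k i) = (\<Sum>i\<in>Y. s * g i + k i mod s)"
      by (rule sum.cong[OF refl]) (rule ki)
    also have "\<dots> = s * j + (\<Sum>i\<in>Y. k i mod s)"
      by (simp add: sum.distrib g flip: sum_distrib_left)
    finally have le: "(\<Sum>i\<in>Y. k i mod s) \<le> 1" using w0[of k] k D by (cases "D < (\<Sum>i\<in>Y. k i)") auto
    have kout: "k i = undefined" if "i \<notin> Y" for i
      using k that by (auto simp: K_def)
    show ?thesis
    proof (cases "\<exists>i\<in>Y. k i mod s \<noteq> 0")
      case False
      then have "k = k0" using ki kout by (auto simp: k0_def fun_eq_iff)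
      then show ?thesis ..
    next
      case True
      then obtain i where i: "i \<in> Y" "k i mod s \<noteq> 0" by blast
      have "(\<Sum>i\<in>Y. k i mod s) = k i mod s + (\<Sum>i\<in>Y - {i}. k i mod s)"
        using i Y by (simp add: sum.remove)
      then have 1: "k i mod s = 1" and "(\<Sum>i\<in>Y - {i}. k i mod s) = 0" using le i by linarith+
      then have 0: "k l mod s = 0" if "l \<in> Y" "l \<noteq> i" for l using that Y by auto
      have "k = kk i"
      proof
        fix l show "k l = kk i l"
          using ki[of l] kout[of l] 0[of l] 1 i by (cases "l \<in> Y"; cases "l = i") (auto simp: kk_def k0_def)
      qed
      then show ?thesis using i by blast
    qed
  qed
  define A0 where "A0 = (if k0 \<in> ?K then w k0 else 0)"
  define A where "A i = (if kk i \<in> ?K then w (kk i) else 0)" for i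
  have k0_mod: "k0 i mod s = 0" if "i \<in> Y" for i
    using that by (simp add: k0_def)
  have kk_mod: "kk i l mod s = (if l = i then 1 else 0)" if "i \<in> Y" "l \<in> Y" for i l
  proof (cases "l = i")
    case True
    have "Suc (s * g i) mod s = 1" using s mod_mult_self2[of 1 s "g i"] by (simp add: mult.commute)
    then show ?thesis using True by (simp add: kk_def)
  qed (use that in \<open>simp add: kk_def k0_def\<close>)
  have kk_inj: "inj_on kk Y"
  proof (rule inj_onI, rule ccontr)
    fix i l assume i: "i \<in> Y" and l: "l \<in> Y" and eq: "kk i = kk l" and ne: "i \<noteq> l"
    show False using kk_mod[OF i i] kk_mod[OF l i] eq ne by simp
  qed
  have k0_notin: "k0 \<notin> kk ` Y"
  proof
    assume "k0 \<in> kk ` Y"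
    then obtain i where i: "i \<in> Y" "k0 = kk i" by blast
    show False using k0_mod[OF i(1)] kk_mod[OF i(1) i(1)] i(2) by simp
  qed
  have affine: "(\<Sum>k\<in>?K. w k * (\<Prod>i\<in>Y. of_nat (\<kappa> i) ^ (k i mod s))) =
      A0 + (\<Sum>i\<in>Y. A i * of_nat (\<kappa> i))" for \<kappa>
  proof -
    let ?f = "\<lambda>k. if k \<in> ?K then w k * (\<Prod>i\<in>Y. of_nat (\<kappa> i) ^ (k i mod s)) else 0"
    have "(\<Sum>k\<in>?K. w k * (\<Prod>i\<in>Y. of_nat (\<kappa> i) ^ (k i mod s))) = (\<Sum>k\<in>?K. ?f k)"
      by (intro sum.cong) auto
    also have "\<dots> = (\<Sum>k\<in>insert k0 (kk ` Y). ?f k)"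
      by (rule sum.mono_neutral_cong) (use K Y split in auto)
    also have "\<dots> = ?f k0 + (\<Sum>i\<in>Y. ?f (kk i))"
      using Y k0_notin by (simp only: sum.insert finite_imageI not_False_eq_True sum.reindex[OF kk_inj] o_def)
    also have "?f k0 = A0"
      by (simp add: A0_def k0_mod)
    also have "(\<Sum>i\<in>Y. ?f (kk i)) = (\<Sum>i\<in>Y. A i * of_nat (\<kappa> i))"
    proof (rule sum.cong[OF refl])
      fix i assume i: "i \<in> Y"
      have "(\<Prod>l\<in>Y. of_nat (\<kappa> l) ^ (kk i l mod s)) = (\<Prod>l\<in>Y. if l = i then of_nat (\<kappa> l) else (1::'k))"
        using i by (intro prod.cong) (auto simp: kk_mod)
      then have "(\<Prod>l\<in>Y. of_nat (\<kappa> l) ^ (kk i l mod s)) = (of_nat (\<kappa> i) :: 'k)"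
        using i Y by (simp add: prod.delta)
      then show "?f (kk i) = A i * of_nat (\<kappa> i)" by (simp add: A_def)
    qed
    finally show ?thesis .
  qed
  have main: "(\<Sum>m\<in>J. x m * hasse_monomial Y (e m) g (\<lambda>i. of_nat (\<kappa> i))) =
        (\<Prod>i\<in>Y. grid_slope s (\<kappa> i) ^ g i) * (A0 + (\<Sum>i\<in>Y. A i * of_nat (\<kappa> i)))"
    if "\<kappa> \<in> grid Y s" for \<kappa>
    unfolding expand affine[symmetric] using leading[OF that, of g] low by (simp add: g)
  have sum_k0: "(\<Sum>i\<in>Y. k0 i) = s * j"
    by (simp add: k0_def g flip: sum_distrib_left)
  have sum_kk: "(\<Sum>l\<in>Y. kk i l) = Suc (s * j)" if "i \<in> Y" for i
  proof -
    have "(\<Sum>l\<in>Y. kk i l) = (\<Sum>l\<in>Y. s * g l + (if l = i then 1 else 0))"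
      using that by (intro sum.cong) (auto simp: kk_def k0_def)
    also have "\<dots> = Suc (s * j)"
      using that Y by (simp add: sum.distrib g flip: sum_distrib_left)
    finally show ?thesis .
  qed
  have "\<forall>i\<in>Y. A i = 0" if "D \<le> s * j"
    using w0 sum_kk that by (auto simp: A_def)
  moreover have "A0 = 0" if "D < s * j"
    using w0[of k0] sum_k0 that by (simp add: A0_def)
  ultimately show ?thesis using main by blast
qed

section \<open>Fat points on the lines over a grid\<close>

text \<open>The exponents \<open>e m\<close>, \<open>m \<in> J\<close>, are those of a polynomial of degree at most \<open>s * \<mu>\<close> in the variables
  \<open>Y\<close> and \<open>z\<close>.  The grid in the variables \<open>Y\<close> carries one line parallel to the \<open>z\<close>-axis over each of its
  points.  Special roles are played by the line over \<open>Q z\<close>, whose points are shifted, and by the lines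
  over \<open>Q i\<close>, \<open>i \<in> Y\<close>, on which one point will move in the direction \<open>i\<close>.  They avoid the origin and the
  unit vectors, because an affine function is determined by its values there.\<close>

locale grid_system =
  fixes Y :: "'v set" and z :: 'v and J :: "'m set" and e :: "'m \<Rightarrow> 'v \<Rightarrow> nat"
    and s \<mu> :: nat and Q :: "'v \<Rightarrow> 'v \<Rightarrow> nat"
  assumes Y: "finite Y" and z: "z \<notin> Y" and J: "finite J" and s: "2 \<le> s" and \<mu>: "1 \<le> \<mu>"
    and deg: "\<And>m. m \<in> J \<Longrightarrow> (\<Sum>i\<in>Y. e m i) + e m z \<le> s * \<mu>"
    and Q_grid: "\<And>i. i \<in> insert z Y \<Longrightarrow> Q i \<in> grid Y s"
    and Q_inj: "inj_on Q (insert z Y)"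
    and Q_origin: "\<And>i. i \<in> insert z Y \<Longrightarrow> Q i \<noteq> restrict (\<lambda>_. 0) Y"
    and Q_unit: "\<And>i l. i \<in> insert z Y \<Longrightarrow> l \<in> Y \<Longrightarrow> Q i \<noteq> (restrict (\<lambda>_. 0) Y)(l := 1)"
begin

definition point :: "('v \<Rightarrow> nat) \<Rightarrow> nat \<Rightarrow> 'v \<Rightarrow> 'k :: field_char_0" where
  "point \<kappa> a i = (if i = z then of_nat a + (if \<kappa> = Q z then 1 else 0) else of_nat (\<kappa> i))"

definition taylor :: "('m \<Rightarrow> 'k :: field_char_0) \<Rightarrow> ('v \<Rightarrow> nat) \<Rightarrow> ('v \<Rightarrow> 'k) \<Rightarrow> 'k" where
  "taylor x g c = (\<Sum>m\<in>J. x m * hasse_monomial (insert z Y) (e m) g c)"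

text \<open>The coefficient of \<open>u\<^sup>g\<close> in the expansion around the line over \<open>\<kappa>\<close>, as a polynomial in \<open>z\<close>.\<close>

definition line_poly :: "('m \<Rightarrow> 'k :: field_char_0) \<Rightarrow> ('v \<Rightarrow> nat) \<Rightarrow> ('v \<Rightarrow> nat) \<Rightarrow> 'k poly" where
  "line_poly x g \<kappa> =
     (\<Sum>m\<in>J. monom (x m * hasse_monomial Y (e m) g (\<lambda>i. of_nat (\<kappa> i))) (e m z))"

lemma coeff_line_poly:
  "coeff (line_poly x g \<kappa>) l =
     (\<Sum>m\<in>{m\<in>J. e m z = l}. x m * hasse_monomial Y (e m) g (\<lambda>i. of_nat (\<kappa> i)))"
proof -
  have "coeff (line_poly x g \<kappa>) l =
      (\<Sum>m\<in>J. if e m z = l then x m * hasse_monomial Y (e m) g (\<lambda>i. of_nat (\<kappa> i)) else 0)"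
    by (simp add: line_poly_def coeff_sum)
  then show ?thesis by (simp add: sum.inter_filter[OF J])
qed

lemma taylor_eq_coeff_line_poly:
  fixes x :: "'m \<Rightarrow> 'k :: field_char_0"
  shows "taylor x g (point \<kappa> a) = coeff (pcompose (line_poly x g \<kappa>) [:point \<kappa> a z, 1:]) (g z)"
proof -
  have "hasse_monomial (insert z Y) (e m) g (point \<kappa> a) =
      hasse_monomial Y (e m) g (\<lambda>i. of_nat (\<kappa> i)) *
      (of_nat (e m z choose g z) * (point \<kappa> a z :: 'k) ^ (e m z - g z))" for m
  proof -
    have "hasse_monomial Y (e m) g (\<lambda>i. of_nat (\<kappa> i)) = (hasse_monomial Y (e m) g (point \<kappa> a) :: 'k)"
      using z by (intro hasse_monomial_cong) (auto simp: point_def)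
    then show ?thesis using Y z by (simp add: hasse_monomial_def mult.commute)
  qed
  then show ?thesis
    by (simp add: taylor_def line_poly_def pcompose_sum coeff_sum coeff_translated_monom mult.assoc)
qed

text \<open>The coefficient of \<open>z\<^sup>l\<close> is a polynomial of degree at most \<open>s * \<mu> - l\<close> in the other variables, and it
  vanishes to order \<open>j\<close> on the grid.  The three cases are those of degree less than, equal to, and one
  more than \<open>s * j\<close>.\<close>

lemma leading_coeffs_line_poly:
  assumes low: "\<And>g \<kappa>. (\<Sum>i\<in>Y. g i) < j \<Longrightarrow> \<kappa> \<in> grid Y s \<Longrightarrow> line_poly x g \<kappa> = 0"
    and g: "(\<Sum>i\<in>Y. g i) = j"
  shows "s * \<mu> < s * j + l \<Longrightarrow> \<kappa> \<in> grid Y s \<Longrightarrow> coeff (line_poly x g \<kappa>) l = 0"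
    and "s * \<mu> = s * j + l \<Longrightarrow> \<exists>c. \<forall>\<kappa>\<in>grid Y s.
      coeff (line_poly x g \<kappa>) l = (\<Prod>i\<in>Y. grid_slope s (\<kappa> i) ^ g i) * c"
    and "s * \<mu> = s * j + l + 1 \<Longrightarrow> \<exists>A0 A. \<forall>\<kappa>\<in>grid Y s.
      coeff (line_poly x g \<kappa>) l =
        (\<Prod>i\<in>Y. grid_slope s (\<kappa> i) ^ g i) * (A0 + (\<Sum>i\<in>Y. A i * of_nat (\<kappa> i)))"
proof -
  have *: "\<exists>A0 A. (\<forall>\<kappa>\<in>grid Y s. coeff (line_poly x g \<kappa>) l =
        (\<Prod>i\<in>Y. grid_slope s (\<kappa> i) ^ g i) * (A0 + (\<Sum>i\<in>Y. A i * of_nat (\<kappa> i)))) \<and>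
      (s * \<mu> - l \<le> s * j \<longrightarrow> (\<forall>i\<in>Y. A i = 0)) \<and> (s * \<mu> - l < s * j \<longrightarrow> A0 = 0)"
    if "s * \<mu> \<le> s * j + l + 1"
    unfolding coeff_line_poly
  proof (rule leading_coefficients_on_grid[where j=j])
    show "(\<Sum>i\<in>Y. e m i) \<le> s * \<mu> - l" if "m \<in> {m\<in>J. e m z = l}" for m
      using deg[of m] that by auto
    show "(\<Sum>m\<in>{m\<in>J. e m z = l}. x m * hasse_monomial Y (e m) g (\<lambda>i. of_nat (\<kappa> i))) = 0"
      if "\<kappa> \<in> grid Y s" "(\<Sum>i\<in>Y. g i) < j" for \<kappa> g
      using low[OF that(2,1)] coeff_line_poly[of x g \<kappa> l] by simp
  qed (use Y J s g that in auto)
  show "coeff (line_poly x g \<kappa>) l = 0" if "s * \<mu> < s * j + l" "\<kappa> \<in> grid Y s"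
  proof (cases "l \<le> s * \<mu>")
    case True
    with * that show ?thesis by fastforce
  next
    case False
    then have "{m\<in>J. e m z = l} = {}" using deg by fastforce
    then show ?thesis by (simp only: coeff_line_poly sum.empty)
  qed
  show "\<exists>c. \<forall>\<kappa>\<in>grid Y s. coeff (line_poly x g \<kappa>) l = (\<Prod>i\<in>Y. grid_slope s (\<kappa> i) ^ g i) * c"
    if "s * \<mu> = s * j + l"
    using * that by fastforce
  show "\<exists>A0 A. \<forall>\<kappa>\<in>grid Y s. coeff (line_poly x g \<kappa>) l =
        (\<Prod>i\<in>Y. grid_slope s (\<kappa> i) ^ g i) * (A0 + (\<Sum>i\<in>Y. A i * of_nat (\<kappa> i)))"
    if "s * \<mu> = s * j + l + 1"
    using * that by auto
qed

lemma slope_product_nonzero: "(\<Prod>i\<in>Y. grid_slope s (\<kappa> i) ^ g i) \<noteq> (0 :: 'k :: field_char_0)"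
  using Y by (simp add: grid_slope_nonzero)

text \<open>On a line over the origin or a unit vector the points sit at \<open>0, \<dots>, s - 1\<close>, so the second highest
  coefficient is a fixed multiple of the highest one, which does not depend on the line.  An affine
  function with equal values at these places is constant.  The shifted line asks for another
  multiple, which is impossible unless both coefficients vanish.  Only lines over points outside
  \<open>Q ` Y\<close> enter the comparison, so the lemma also applies to the first-order term of a deformation that
  moves points on the lines over \<open>Q ` Y\<close>.\<close>

lemma top_coeffs_line_poly_zero:
  fixes x :: "'m \<Rightarrow> 'k :: field_char_0"
  assumes low: "\<And>g \<kappa>. (\<Sum>i\<in>Y. g i) < j \<Longrightarrow> \<kappa> \<in> grid Y s \<Longrightarrow> line_poly x g \<kappa> = 0"
    and g: "(\<Sum>i\<in>Y. g i) = j" and j: "j < \<mu>"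
    and dvd: "\<And>\<kappa> a. \<kappa> \<in> grid Y s \<Longrightarrow> \<kappa> \<notin> Q ` Y \<Longrightarrow> a < s \<Longrightarrow>
      [:- point \<kappa> a z, 1:] ^ (\<mu> - j) dvd line_poly x g \<kappa>"
    and \<kappa>: "\<kappa> \<in> grid Y s" and l: "s * (\<mu> - j) \<le> l + 1"
  shows "coeff (line_poly x g \<kappa>) l = 0"
proof -
  let ?q = "\<mu> - j" and ?u = "\<lambda>\<kappa>. \<Prod>i\<in>Y. grid_slope s (\<kappa> i) ^ g i :: 'k"
  define p where "p = coeff (grid_poly s ^ ?q :: 'k poly) (s * ?q - 1)"
  have q: "0 < ?q" using j by simp
  have sq: "0 < s * ?q" using q s by simp
  have s\<mu>: "s * \<mu> = s * j + s * ?q" using j by (simp flip: distrib_left)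
  obtain c where c: "\<And>\<kappa>. \<kappa> \<in> grid Y s \<Longrightarrow> coeff (line_poly x g \<kappa>) (s * ?q) = ?u \<kappa> * c"
    using leading_coeffs_line_poly(2)[OF low g s\<mu>] by blast
  have "s * \<mu> = s * j + (s * ?q - 1) + 1" using s\<mu> sq by simp
  then obtain A0 A where A: "\<And>\<kappa>. \<kappa> \<in> grid Y s \<Longrightarrow>
      coeff (line_poly x g \<kappa>) (s * ?q - 1) = ?u \<kappa> * (A0 + (\<Sum>i\<in>Y. A i * of_nat (\<kappa> i)))"
    using leading_coeffs_line_poly(3)[OF low g] by blast
  have sub: "A0 + (\<Sum>i\<in>Y. A i * of_nat (\<kappa> i)) =
      c * (p - of_nat (s * ?q) * (if \<kappa> = Q z then 1 else 0))"
    if \<kappa>: "\<kappa> \<in> grid Y s" and nQ: "\<kappa> \<notin> Q ` Y" for \<kappa>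
  proof -
    let ?h = "line_poly x g \<kappa>" and ?b = "if \<kappa> = Q z then 1 else 0 :: 'k"
    have "coeff ?h (s * ?q - 1) = coeff ?h (s * ?q) * (p - of_nat (s * ?q) * ?b)"
      unfolding p_def
    proof (rule subleading_coeff_of_multiple_of_grid_power[OF q])
      show "coeff ?h l = 0" if "s * ?q < l" for l
        using leading_coeffs_line_poly(1)[OF low g _ \<kappa>, of l] that s\<mu> by simp
      show "[:- (of_nat a + ?b), 1:] ^ ?q dvd ?h" if "a < s" for a
        using dvd[OF \<kappa> nQ that] by (simp add: point_def)
    qed (use s in simp)
    then have "?u \<kappa> * (A0 + (\<Sum>i\<in>Y. A i * of_nat (\<kappa> i))) = ?u \<kappa> * (c * (p - of_nat (s * ?q) * ?b))"
      using c[OF \<kappa>] A[OF \<kappa>] by (simp only: mult.assoc)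
    then show ?thesis by (simp only: mult_left_cancel[OF slope_product_nonzero])
  qed
  let ?o = "restrict (\<lambda>_. 0) Y :: 'v \<Rightarrow> nat"
  have o: "?o \<in> grid Y s" "?o \<notin> Q ` Y" "?o \<noteq> Q z"
    using s Q_origin[of z] Q_origin by (auto simp: image_iff) metis+
  have "(\<Sum>i\<in>Y. A i * of_nat (?o i)) = 0" by (intro sum.neutral) auto
  with sub[OF o(1,2)] o(3) have A0: "A0 = c * p" by simp
  have Ai: "A i = 0" if i: "i \<in> Y" for i
  proof -
    let ?e = "?o(i := 1)"
    have ei: "?e \<in> grid Y s" "?e \<notin> Q ` Y" "?e \<noteq> Q z"
      using s i Q_unit[OF _ i] Q_unit[OF insertI1 i] by (auto simp: PiE_iff extensional_def image_iff) metis+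
    have "(\<Sum>l\<in>Y. A l * of_nat (?e l)) = (\<Sum>l\<in>Y. if l = i then A i else 0)"
      by (intro sum.cong) auto
    then have "(\<Sum>l\<in>Y. A l * of_nat (?e l)) = A i" using i Y by simp
    with sub[OF ei(1,2)] ei(3) A0 show ?thesis by simp
  qed
  have "Q z \<in> grid Y s" "Q z \<notin> Q ` Y"
    using Q_grid Q_inj z by (auto simp: inj_on_def)
  from sub[OF this] have "c * of_nat (s * ?q) = 0" using A0 Ai by (simp add: algebra_simps)
  then have c0: "c = 0" using sq by (metis mult_eq_0_iff of_nat_eq_0_iff less_irrefl)
  then have A00: "A0 = 0" using A0 by simp
  consider "s * ?q < l" | "l = s * ?q" | "l = s * ?q - 1" using l by linarith
  then show ?thesis
  proof cases
    case 1 then show ?thesis using leading_coeffs_line_poly(1)[OF low g _ \<kappa>, of l] s\<mu> by simp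
  next
    case 2 then show ?thesis using c[OF \<kappa>] c0 by simp
  next
    case 3 then show ?thesis using A[OF \<kappa>] A00 Ai by simp
  qed
qed

lemma line_poly_cong:
  assumes "\<And>i. i \<in> Y \<Longrightarrow> g i = g' i"
  shows "line_poly x g \<kappa> = line_poly x g' \<kappa>"
  unfolding line_poly_def
  by (intro sum.cong refl arg_cong2[where f=monom] arg_cong2[where f="(*)"] hasse_monomial_cong)
     (use assms in auto)

text \<open>The Taylor coefficient of order \<open>l\<close> of the line polynomial is one of total order \<open>\<bar>g\<bar> + l\<close> in all
  variables.\<close>

lemma power_dvd_line_poly:
  assumes "\<And>h. (\<forall>i\<in>Y. h i = g i) \<Longrightarrow> (\<Sum>i\<in>insert z Y. h i) < \<mu> \<Longrightarrow> taylor x h (point \<kappa> a) = 0"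
  shows "[:- point \<kappa> a z, 1:] ^ (\<mu> - (\<Sum>i\<in>Y. g i)) dvd line_poly x g \<kappa>"
proof (rule translated_coeffs_zero_imp_power_dvd)
  fix l assume l: "l < \<mu> - (\<Sum>i\<in>Y. g i)"
  let ?h = "g(z := l)"
  have eq: "\<forall>i\<in>Y. ?h i = g i" using z by auto
  then have "(\<Sum>i\<in>insert z Y. ?h i) = l + (\<Sum>i\<in>Y. g i)" using Y z by simp
  then have "taylor x ?h (point \<kappa> a) = 0" using l by (intro assms[OF eq]) simp
  then show "coeff (pcompose (line_poly x g \<kappa>) [:point \<kappa> a z, 1:]) l = 0"
    using taylor_eq_coeff_line_poly[of x ?h \<kappa> a] line_poly_cong[of ?h g x \<kappa>] eq by simp
qed

lemma card_points: "card ((\<lambda>a. point \<kappa> a z :: 'k :: field_char_0) ` A) = card A"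
  by (intro card_image) (auto simp: inj_on_def point_def)

text \<open>Order by order: once the lower coefficients vanish, the next one has degree less than the number of
  its zeros on each line.\<close>

lemma line_poly_zero_below:
  fixes x :: "'m \<Rightarrow> 'k :: field_char_0"
  assumes n: "n \<le> \<mu>"
    and vanish: "\<And>\<kappa> a g. \<kappa> \<in> grid Y s \<Longrightarrow> a < s \<Longrightarrow> (\<Sum>i\<in>insert z Y. g i) < \<mu> \<Longrightarrow>
      (\<Sum>i\<in>Y. g i) < n \<Longrightarrow> taylor x g (point \<kappa> a) = 0"
    and g: "(\<Sum>i\<in>Y. g i) < n" and \<kappa>: "\<kappa> \<in> grid Y s"
  shows "line_poly x g \<kappa> = 0"
  using g \<kappa>
proof (induction "\<Sum>i\<in>Y. g i" arbitrary: g \<kappa> rule: less_induct)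
  case less
  let ?j = "\<Sum>i\<in>Y. g i"
  have low: "line_poly x g' \<kappa>' = 0" if "(\<Sum>i\<in>Y. g' i) < ?j" "\<kappa>' \<in> grid Y s" for g' \<kappa>'
    using less.hyps[OF that(1) _ that(2)] that(1) less.prems(1) by simp
  have dvd: "[:- point \<kappa> a z, 1:] ^ (\<mu> - ?j) dvd line_poly x g \<kappa>" if "\<kappa> \<in> grid Y s" "a < s" for \<kappa> a
    using that less.prems(1) by (intro power_dvd_line_poly vanish) auto
  have j: "?j < \<mu>" using less.prems(1) n by simp
  show ?case
  proof (rule poly_eq_0_of_multiple_roots[of "(\<lambda>a. point \<kappa> a z) ` {..<s}" "\<mu> - ?j"])
    show "coeff (line_poly x g \<kappa>) l = 0"
      if "card ((\<lambda>a. point \<kappa> a z :: 'k) ` {..<s}) * (\<mu> - ?j) \<le> l" for l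
      using top_coeffs_line_poly_zero[OF low refl j _ less.prems(2), of l] dvd that
      by (simp add: card_points)
  qed (use dvd less.prems j in auto)
qed

text \<open>The conditions on \<open>x0\<close> alone leave the combinations of the products \<open>f\<^sup>\<alpha>\<close> with \<open>\<bar>\<alpha>\<bar> = \<mu>\<close>, where \<open>f\<^sub>i\<close> is
  \<open>grid_poly s\<close> in the variable \<open>i\<close>.  The derivative of such a combination enters the conditions on
  \<open>x1\<close> only in order \<open>\<mu> - 1\<close> and only at the moving points.  There the argument of the static case
  still lowers the degree of \<open>x1\<close> on the line so far that its \<open>s - 1\<close> other zeros make it vanish, and
  with it the derivative.  Together the two conditions say that \<open>x0 + t * x1\<close> satisfies, up to first order
  in \<open>t\<close>, the vanishing conditions at points of which the one with \<open>a = 0\<close> on the line over \<open>Q i\<close> moves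
  with unit speed in the direction \<open>i\<close>.\<close>

lemma first_order_rigidity:
  fixes x0 x1 :: "'m \<Rightarrow> 'k :: field_char_0"
  assumes inj: "\<And>m m'. m \<in> J \<Longrightarrow> m' \<in> J \<Longrightarrow> (\<forall>i\<in>insert z Y. e m i = e m' i) \<Longrightarrow> m = m'"
    and ker: "\<And>\<kappa> a g. \<kappa> \<in> grid Y s \<Longrightarrow> a < s \<Longrightarrow> (\<Sum>i\<in>insert z Y. g i) < \<mu> \<Longrightarrow>
      taylor x0 g (point \<kappa> a) = 0"
    and first: "\<And>\<kappa> a g. \<kappa> \<in> grid Y s \<Longrightarrow> a < s \<Longrightarrow> (\<Sum>i\<in>insert z Y. g i) < \<mu> \<Longrightarrow>
      taylor x1 g (point \<kappa> a) + (\<Sum>i\<in>Y. (if \<kappa> = Q i \<and> a = 0 then 1 else 0) *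
        (of_nat (Suc (g i)) * taylor x0 (g(i := Suc (g i))) (point \<kappa> a))) = 0"
    and m: "m \<in> J"
  shows "x0 m = 0"
proof -
  have low0: "line_poly x0 g \<kappa> = 0" if "(\<Sum>i\<in>Y. g i) < \<mu>" "\<kappa> \<in> grid Y s" for g \<kappa>
    using line_poly_zero_below[of \<mu> x0 g \<kappa>] ker that by simp
  have taylor_low: "taylor x0 g (point \<kappa> a) = 0" if "(\<Sum>i\<in>Y. g i) < \<mu>" "\<kappa> \<in> grid Y s" for g \<kappa> a
    using low0[OF that] by (simp add: taylor_eq_coeff_line_poly)
  have sum_upd: "(\<Sum>l\<in>Y. (g(i := Suc (g i))) l) = Suc (\<Sum>l\<in>Y. g l)" if "i \<in> Y" for g :: "'v \<Rightarrow> nat" and i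
    using that Y by (simp add: sum.remove[of Y i] sum.remove[of Y i g])
  have low1: "line_poly x1 g \<kappa> = 0" if "(\<Sum>i\<in>Y. g i) < \<mu> - 1" "\<kappa> \<in> grid Y s" for g \<kappa>
  proof (rule line_poly_zero_below[OF _ _ that])
    show "taylor x1 g (point \<kappa> a) = 0"
      if "\<kappa> \<in> grid Y s" "a < s" "(\<Sum>i\<in>insert z Y. g i) < \<mu>" "(\<Sum>i\<in>Y. g i) < \<mu> - 1" for \<kappa> a g
    proof -
      have "(\<Sum>i\<in>Y. (if \<kappa> = Q i \<and> a = 0 then 1 else 0) *
        (of_nat (Suc (g i)) * taylor x0 (g(i := Suc (g i))) (point \<kappa> a))) = 0"
        using that sum_upd by (intro sum.neutral ballI) (simp add: taylor_low)
      then show ?thesis using first[OF that(1-3)] by simp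
    qed
  qed simp
  \<comment> \<open>The coefficients of \<open>x0\<close> of order \<open>\<mu>\<close> at the moving points.\<close>
  have edge: "taylor x0 (g(i := Suc (g i))) (point (Q i) 0) = 0"
    if g: "(\<Sum>l\<in>Y. g l) = \<mu> - 1" and gz: "g z = 0" and i: "i \<in> Y" for g i
  proof -
    have g1: "\<mu> - (\<Sum>l\<in>Y. g l) = 1" and gl: "(\<Sum>l\<in>Y. g l) < \<mu>" using g \<mu> by simp_all
    have fixed: "[:- point \<kappa> a z, 1:] ^ (\<mu> - (\<Sum>l\<in>Y. g l)) dvd line_poly x1 g \<kappa>"
      if \<kappa>: "\<kappa> \<in> grid Y s" and a: "a < s" and st: "\<kappa> \<notin> Q ` Y \<or> a \<noteq> 0" for \<kappa> a
    proof (rule power_dvd_line_poly)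
      fix h :: "'v \<Rightarrow> nat" assume "\<forall>i\<in>Y. h i = g i" and h: "(\<Sum>i\<in>insert z Y. h i) < \<mu>"
      have "(\<Sum>i\<in>Y. (if \<kappa> = Q i \<and> a = 0 then 1 else 0) *
        (of_nat (Suc (h i)) * taylor x0 (h(i := Suc (h i))) (point \<kappa> a))) = 0"
        using st by (intro sum.neutral) auto
      then show "taylor x1 h (point \<kappa> a) = 0" using first[OF \<kappa> a h] by simp
    qed
    have Qi: "Q i \<in> grid Y s" using Q_grid i by simp
    have top: "coeff (line_poly x1 g (Q i)) l = 0" if "s \<le> l + 1" for l
    proof (rule top_coeffs_line_poly_zero[OF _ refl gl _ Qi])
      show "line_poly x1 g' \<kappa> = 0" if "(\<Sum>l\<in>Y. g' l) < (\<Sum>l\<in>Y. g l)" "\<kappa> \<in> grid Y s" for g' \<kappa>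
        using low1 that g by simp
    qed (use fixed g1 that in auto)
    have "line_poly x1 g (Q i) = 0"
    proof (rule poly_eq_0_of_multiple_roots[of "(\<lambda>a. point (Q i) a z) ` {1..<s}" 1])
      show "[:- c, 1:] ^ 1 dvd line_poly x1 g (Q i)" if "c \<in> (\<lambda>a. point (Q i) a z) ` {1..<s}" for c
        using fixed[OF Qi] that g1 by auto
    qed (use top in \<open>auto simp: card_points\<close>)
    then have "taylor x1 g (point (Q i) 0) = 0" by (simp add: taylor_eq_coeff_line_poly)
    moreover have "(\<Sum>l\<in>insert z Y. g l) < \<mu>" using gz gl Y z by simp
    ultimately have "(\<Sum>l\<in>Y. (if Q i = Q l then 1 else 0) *
        (of_nat (Suc (g l)) * taylor x0 (g(l := Suc (g l))) (point (Q i) 0))) = 0"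
      using first[OF Qi, of 0 g] s by simp
    also have "(\<Sum>l\<in>Y. (if Q i = Q l then 1 else 0) *
        (of_nat (Suc (g l)) * taylor x0 (g(l := Suc (g l))) (point (Q i) 0))) =
      (\<Sum>l\<in>Y. if l = i then of_nat (Suc (g i)) * taylor x0 (g(i := Suc (g i))) (point (Q i) 0) else 0)"
      using Q_inj i by (intro sum.cong) (auto simp: inj_on_def)
    finally show ?thesis using i Y by (simp del: of_nat_Suc)
  qed
  have all: "line_poly x0 g \<kappa> = 0" if "\<kappa> \<in> grid Y s" for g \<kappa>
    using that
  proof (induction "\<Sum>i\<in>Y. g i" arbitrary: g \<kappa> rule: less_induct)
    case less
    let ?j = "\<Sum>i\<in>Y. g i"
    have low: "line_poly x0 g' \<kappa>' = 0" if "(\<Sum>i\<in>Y. g' i) < ?j" "\<kappa>' \<in> grid Y s" for g' \<kappa>'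
      using less.hyps that by blast
    consider "?j < \<mu>" | "?j = \<mu>" | "\<mu> < ?j" by linarith
    then show ?case
    proof cases
      case 1 then show ?thesis using low0 less.prems by blast
    next
      case 3
      then have "s * \<mu> < s * ?j" using s by simp
      then have "coeff (line_poly x0 g \<kappa>) l = 0" for l
        by (intro leading_coeffs_line_poly(1)[OF low refl _ less.prems] trans_less_add1)
      then show ?thesis by (intro poly_eqI) simp
    next
      case 2
      have pos: "coeff (line_poly x0 g \<kappa>) l = 0" if "0 < l" "\<kappa> \<in> grid Y s" for l \<kappa>
        using leading_coeffs_line_poly(1)[OF low refl _ that(2)] that(1) 2 by simp
      obtain c where c: "\<And>\<kappa>. \<kappa> \<in> grid Y s \<Longrightarrow>
          coeff (line_poly x0 g \<kappa>) 0 = (\<Prod>i\<in>Y. grid_slope s (\<kappa> i) ^ g i) * c"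
        using leading_coeffs_line_poly(2)[of ?j x0 g 0, OF low refl] 2 by fastforce
      \<comment> \<open>Each exponent of total \<open>\<mu>\<close> arises from one of total \<open>\<mu> - 1\<close> by
        raising some entry, and then \<open>edge\<close> applies on the line over \<open>Q i\<close>.\<close>
      have "\<exists>i\<in>Y. 0 < g i"
      proof (rule ccontr)
        assume "\<not> ?thesis"
        then have "?j = 0" by simp
        then show False using 2 \<mu> by simp
      qed
      then obtain i where i: "i \<in> Y" "0 < g i" by blast
      define g' where "g' = g(i := g i - 1, z := 0)"
      have iz: "i \<noteq> z" using i z by auto
      have g'g: "\<forall>l\<in>Y. (g'(i := Suc (g' i))) l = g l"
        using i z iz by (auto simp: g'_def)
      have "Suc (\<Sum>l\<in>Y. g' l) = (\<Sum>l\<in>Y. (g'(i := Suc (g' i))) l)"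
        by (rule sum_upd[OF i(1), symmetric])
      also have "\<dots> = ?j" using g'g by (intro sum.cong) auto
      finally have "(\<Sum>l\<in>Y. g' l) = \<mu> - 1" using 2 by simp
      moreover have "g' z = 0" by (simp add: g'_def)
      ultimately have "taylor x0 (g'(i := Suc (g' i))) (point (Q i) 0) = 0" using i by (intro edge)
      moreover have "line_poly x0 (g'(i := Suc (g' i))) (Q i) = line_poly x0 g (Q i)"
        by (rule line_poly_cong) (use g'g in blast)
      moreover have "line_poly x0 g (Q i) = [:coeff (line_poly x0 g (Q i)) 0:]"
        using pos[of _ "Q i"] Q_grid i by (intro poly_eqI) (auto simp: coeff_pCons split: nat.splits)
      moreover have "(g'(i := Suc (g' i))) z = 0" using iz by (simp add: g'_def)
      ultimately have "coeff (line_poly x0 g (Q i)) 0 = 0"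
        by (metis taylor_eq_coeff_line_poly pcompose_const coeff_pCons_0)
      then have "c = 0" using c[of "Q i"] Q_grid i slope_product_nonzero[of "Q i" g, where 'k='k] by simp
      then show ?thesis using c less.prems pos
        by (intro poly_eqI) (metis coeff_0 gr0I mult_zero_right)
    qed
  qed
  let ?o = "restrict (\<lambda>_. 0) Y :: 'v \<Rightarrow> nat"
  have o: "?o \<in> grid Y s" using s by auto
  \<comment> \<open>The expansion around the line over the origin returns the coefficients themselves.\<close>
  have hm: "hasse_monomial Y (e m') (e m) (\<lambda>i. of_nat (?o i)) =
      (if \<forall>i\<in>Y. e m' i = e m i then 1 else 0 :: 'k)" for m'
  proof -
    have "hasse_monomial Y (e m') (e m) (\<lambda>i. of_nat (?o i)) =
        (\<Prod>i\<in>Y. if e m' i = e m i then 1 else 0 :: 'k)"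
      unfolding hasse_monomial_def
    proof (rule prod.cong[OF refl])
      fix i assume "i \<in> Y"
      then show "of_nat (e m' i choose e m i) * of_nat (?o i) ^ (e m' i - e m i) =
          (if e m' i = e m i then 1 else 0 :: 'k)"
        by (cases "e m' i" "e m i" rule: linorder_cases) (auto simp: binomial_eq_0 zero_power)
    qed
    also have "\<dots> = (if \<forall>i\<in>Y. e m' i = e m i then 1 else 0)"
      using Y by (auto intro: prod_zero)
    finally show ?thesis .
  qed
  have "0 = coeff (line_poly x0 (e m) ?o) (e m z)" using all[OF o] by simp
  also have "\<dots> = (\<Sum>m'\<in>{m'\<in>J. e m' z = e m z}. if m' = m then x0 m' else 0)"
    unfolding coeff_line_poly
    by (intro sum.cong refl) (use inj m hm in auto)
  also have "\<dots> = x0 m" using J m by simp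
  finally show ?thesis by simp
qed

end

section \<open>Linear systems with polynomial coefficients\<close>

definition ring_hom :: "('r :: comm_ring_1 \<Rightarrow> 's :: comm_ring_1) \<Rightarrow> bool" where
  "ring_hom \<phi> \<longleftrightarrow> \<phi> 1 = 1 \<and> (\<forall>a b. \<phi> (a + b) = \<phi> a + \<phi> b) \<and> (\<forall>a b. \<phi> (a * b) = \<phi> a * \<phi> b)"

lemma ring_homD:
  assumes "ring_hom \<phi>"
  shows "\<phi> 0 = 0" "\<phi> 1 = 1" "\<phi> (a + b) = \<phi> a + \<phi> b" "\<phi> (a * b) = \<phi> a * \<phi> b"
    "\<phi> (a - b) = \<phi> a - \<phi> b" "\<phi> (of_nat n) = of_nat n" "\<phi> (a ^ n) = \<phi> a ^ n"
    "\<phi> (sum f S) = (\<Sum>x\<in>S. \<phi> (f x))" "\<phi> (prod f S) = (\<Prod>x\<in>S. \<phi> (f x))"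
proof -
  have add: "\<phi> (a + b) = \<phi> a + \<phi> b" and mult: "\<phi> (a * b) = \<phi> a * \<phi> b" and one: "\<phi> 1 = 1" for a b
    using assms by (auto simp: ring_hom_def)
  show zero: "\<phi> 0 = 0" using add[of 0 0] by simp
  show "\<phi> (a - b) = \<phi> a - \<phi> b" using add[of "a - b" b] by simp
  show "\<phi> (of_nat n) = of_nat n" by (induction n) (simp_all add: zero one add)
  show "\<phi> (a ^ n) = \<phi> a ^ n" by (induction n) (simp_all add: one mult)
  show "\<phi> (sum f S) = (\<Sum>x\<in>S. \<phi> (f x))"
    by (induction S rule: infinite_finite_induct) (simp_all add: zero add)
  show "\<phi> (prod f S) = (\<Prod>x\<in>S. \<phi> (f x))"
    by (induction S rule: infinite_finite_induct) (simp_all add: one mult)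
qed (use assms in \<open>auto simp: ring_hom_def\<close>)

text \<open>Semicontinuity of the rank along a family, by Gaussian elimination without fractions.  The matrix has
  entries in a ring of polynomials, \<open>\<phi>\<close> restricts them to a curve of parameters and \<open>\<psi>\<close> evaluates
  them.  Without a kernel along the curve, the product \<open>D\<close> of the pivots is nonzero there, and \<open>D \<noteq> 0\<close>
  excludes a kernel at any parameter.  The predicate \<open>H e\<close> stands for homogeneity of degree \<open>e\<close>, which
  elimination preserves because all entries have the same degree.\<close>

lemma kernel_or_generic_injectivity:
  fixes \<phi> :: "'r :: comm_ring_1 \<Rightarrow> 's :: idom" and M :: "'i \<Rightarrow> 'j \<Rightarrow> 'r"
    and H :: "(nat \<Rightarrow> nat) \<Rightarrow> 'r \<Rightarrow> bool"
  assumes \<phi>: "ring_hom \<phi>"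
    and H1: "H (\<lambda>_. 0) 1"
    and Hmult: "\<And>e e' p q. H e p \<Longrightarrow> H e' q \<Longrightarrow> H (\<lambda>i. e i + e' i) (p * q)"
    and Hdiff: "\<And>e p q. H e p \<Longrightarrow> H e q \<Longrightarrow> H e (p - q)"
    and J: "finite J" and M: "\<And>i j. i \<in> I \<Longrightarrow> j \<in> J \<Longrightarrow> H e (M i j)"
  shows "(\<exists>x. (\<exists>j\<in>J. x j \<noteq> 0) \<and> (\<forall>i\<in>I. (\<Sum>j\<in>J. \<phi> (M i j) * x j) = 0)) \<or>
    (\<exists>D e'. H e' D \<and> \<phi> D \<noteq> 0 \<and> (\<forall>\<psi> :: 'r \<Rightarrow> 'k :: field. ring_hom \<psi> \<and> \<psi> D \<noteq> 0 \<longrightarrow>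
      (\<forall>y. (\<forall>i\<in>I. (\<Sum>j\<in>J. \<psi> (M i j) * y j) = 0) \<longrightarrow> (\<forall>j\<in>J. y j = 0))))"
  using J M
proof (induction J arbitrary: M e rule: finite_induct)
  case empty
  then show ?case using H1 ring_homD(2)[OF \<phi>] by (intro disjI2 exI[of _ 1]) auto
next
  case (insert j0 J)
  show ?case
  proof (cases "\<forall>i\<in>I. \<phi> (M i j0) = 0")
    case True
    have "(\<Sum>j\<in>J. \<phi> (M i j) * (if j = j0 then 1 else 0)) = 0" for i
      using insert.hyps by (intro sum.neutral) auto
    then show ?thesis
      using True insert.hyps by (intro disjI1 exI[of _ "\<lambda>j. if j = j0 then 1 else 0"]) auto
  next
    case False
    then obtain i0 where i0: "i0 \<in> I" "\<phi> (M i0 j0) \<noteq> 0" by blast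
    define M' where "M' i j = M i0 j0 * M i j - M i j0 * M i0 j" for i j
    have M': "H (\<lambda>l. e l + e l) (M' i j)" if "i \<in> I" "j \<in> J" for i j
      unfolding M'_def using insert.prems i0 that by (intro Hdiff Hmult) auto
    show ?thesis
    proof (rule disjE[OF insert.IH[where M=M', OF M']])
      assume "\<exists>x. (\<exists>j\<in>J. x j \<noteq> 0) \<and> (\<forall>i\<in>I. (\<Sum>j\<in>J. \<phi> (M' i j) * x j) = 0)"
      then obtain x where 1: "\<exists>j\<in>J. x j \<noteq> 0" "\<forall>i\<in>I. (\<Sum>j\<in>J. \<phi> (M' i j) * x j) = 0"
        by blast
      define x' where "x' j = (if j = j0 then - (\<Sum>j\<in>J. \<phi> (M i0 j) * x j) else \<phi> (M i0 j0) * x j)" for j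
      have "(\<Sum>j\<in>insert j0 J. \<phi> (M i j) * x' j) = 0" if i: "i \<in> I" for i
      proof -
        have "(\<Sum>j\<in>J. \<phi> (M i j) * x' j) = (\<Sum>j\<in>J. \<phi> (M i j) * (\<phi> (M i0 j0) * x j))"
          using insert.hyps by (intro sum.cong) (auto simp: x'_def)
        then have "(\<Sum>j\<in>insert j0 J. \<phi> (M i j) * x' j) = (\<Sum>j\<in>J. \<phi> (M' i j) * x j)"
          using insert.hyps
          by (simp add: x'_def M'_def ring_homD[OF \<phi>] sum_distrib_left left_diff_distrib
              right_diff_distrib sum_subtractf mult_ac)
        then show ?thesis using 1 i by simp
      qed
      moreover have "\<exists>j\<in>insert j0 J. x' j \<noteq> 0"
        using 1(1) insert.hyps i0 by (auto simp: x'_def)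
      ultimately show ?thesis by blast
    next
      assume "\<exists>D e'. H e' D \<and> \<phi> D \<noteq> 0 \<and>
        (\<forall>\<psi> :: 'r \<Rightarrow> 'k. ring_hom \<psi> \<and> \<psi> D \<noteq> 0 \<longrightarrow>
        (\<forall>y. (\<forall>i\<in>I. (\<Sum>j\<in>J. \<psi> (M' i j) * y j) = 0) \<longrightarrow> (\<forall>j\<in>J. y j = 0)))"
      then obtain D e' where 2: "H e' D" "\<phi> D \<noteq> 0" "\<forall>\<psi> :: 'r \<Rightarrow> 'k. ring_hom \<psi> \<and> \<psi> D \<noteq> 0 \<longrightarrow>
        (\<forall>y. (\<forall>i\<in>I. (\<Sum>j\<in>J. \<psi> (M' i j) * y j) = 0) \<longrightarrow> (\<forall>j\<in>J. y j = 0))"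
        by blast
      have "H (\<lambda>l. e' l + e l) (D * M i0 j0)" using 2 insert.prems i0 by (intro Hmult) auto
      moreover have "\<phi> (D * M i0 j0) \<noteq> 0" using 2 i0 by (simp add: ring_homD[OF \<phi>])
      moreover have "y j = 0"
        if \<psi>: "ring_hom \<psi>" and ne: "\<psi> (D * M i0 j0) \<noteq> 0"
          and y: "\<forall>i\<in>I. (\<Sum>j\<in>insert j0 J. \<psi> (M i j) * y j) = 0" and j: "j \<in> insert j0 J"
        for \<psi> :: "'r \<Rightarrow> 'k" and y j
      proof -
        have nz: "\<psi> D \<noteq> 0" "\<psi> (M i0 j0) \<noteq> 0" using ne by (auto simp: ring_homD[OF \<psi>])
        have row: "(\<Sum>j\<in>J. \<psi> (M i j) * y j) = - \<psi> (M i j0) * y j0" if "i \<in> I" for i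
          using y that insert.hyps by (simp add: eq_neg_iff_add_eq_0 add.commute)
        have "(\<Sum>j\<in>J. \<psi> (M' i j) * y j) = 0" if "i \<in> I" for i
        proof -
          have "(\<Sum>j\<in>J. \<psi> (M' i j) * y j) =
              \<psi> (M i0 j0) * (\<Sum>j\<in>J. \<psi> (M i j) * y j) - \<psi> (M i j0) * (\<Sum>j\<in>J. \<psi> (M i0 j) * y j)"
            by (simp add: M'_def ring_homD[OF \<psi>] sum_distrib_left left_diff_distrib right_diff_distrib sum_subtractf mult_ac)
          then show ?thesis using row[OF that] row[OF i0(1)] by simp
        qed
        then have yJ: "y j = 0" if "j \<in> J" for j using 2(3) \<psi> nz(1) that by blast
        then have "\<psi> (M i0 j0) * y j0 = 0" using row[OF i0(1)] by simp
        then show ?thesis using nz yJ j by auto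
      qed
      ultimately show ?thesis by (intro disjI2 exI conjI) auto
    qed
  qed
qed

section \<open>Evaluation of multivariate polynomials\<close>

lemma prod_keys_superset:
  assumes "finite S" "Poly_Mapping.keys m \<subseteq> S"
  shows "(\<Prod>v\<in>Poly_Mapping.keys m. \<sigma> v ^ Poly_Mapping.lookup m v) =
    (\<Prod>v\<in>S. \<sigma> v ^ Poly_Mapping.lookup m v :: 'b :: comm_ring_1)"
  using assms by (intro prod.mono_neutral_left) (auto simp: in_keys_iff)

lemma sum_keys_superset:
  assumes "finite S" "Poly_Mapping.keys m \<subseteq> S"
  shows "(\<Sum>v\<in>Poly_Mapping.keys m. Poly_Mapping.lookup m v) =
    (\<Sum>v\<in>S. Poly_Mapping.lookup m v)"
  using assms by (intro sum.mono_neutral_left) (auto simp: in_keys_iff)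

lemma poly_mapping_as_sum_of_singles:
  "F = (\<Sum>m\<in>Poly_Mapping.keys F. Poly_Mapping.single m (Poly_Mapping.lookup F m))"
proof (rule poly_mapping_eqI)
  fix k
  have "(\<Sum>m\<in>Poly_Mapping.keys F. Poly_Mapping.lookup (Poly_Mapping.single m (Poly_Mapping.lookup F m)) k) =
      (\<Sum>m\<in>Poly_Mapping.keys F. if m = k then Poly_Mapping.lookup F k else 0)"
    by (intro sum.cong) (auto simp: lookup_single)
  then show "Poly_Mapping.lookup F k = Poly_Mapping.lookup (\<Sum>m\<in>Poly_Mapping.keys F.
      Poly_Mapping.single m (Poly_Mapping.lookup F m)) k"
    by (simp add: lookup_sum in_keys_iff)
qed

lemma msubst_single:
  assumes "ring_hom h"
  shows "msubst h \<sigma> (Poly_Mapping.single m c) =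
    h c * (\<Prod>v\<in>Poly_Mapping.keys m. \<sigma> v ^ Poly_Mapping.lookup m v)"
  by (cases "c = 0") (simp_all add: msubst_def ring_homD[OF assms])

lemma msubst_add:
  assumes "ring_hom h"
  shows "msubst h \<sigma> (F + G) = msubst h \<sigma> F + msubst h \<sigma> G"
  unfolding msubst_def
  by (rule setsum_keys_plus_distrib) (simp_all add: ring_homD[OF assms] distrib_right)

lemma msubst_sum:
  assumes "ring_hom h"
  shows "msubst h \<sigma> (sum f S) = (\<Sum>x\<in>S. msubst h \<sigma> (f x))"
proof -
  have "msubst h \<sigma> 0 = 0" by (simp add: msubst_def)
  then show ?thesis
    by (induction S rule: infinite_finite_induct) (simp_all add: msubst_add[OF assms])
qed

lemma ring_hom_msubst:
  fixes h :: "'k :: comm_ring_1 \<Rightarrow> 'b :: comm_ring_1"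
  assumes h: "ring_hom h"
  shows "ring_hom (msubst h \<sigma>)"
proof -
  let ?mon = "\<lambda>m. \<Prod>v\<in>Poly_Mapping.keys m. \<sigma> v ^ Poly_Mapping.lookup m v"
  have mon_add: "?mon (m + n) = ?mon m * ?mon n" for m n
  proof -
    let ?S = "Poly_Mapping.keys m \<union> Poly_Mapping.keys n"
    have "?mon (m + n) = (\<Prod>v\<in>?S. \<sigma> v ^ Poly_Mapping.lookup (m + n) v)"
      using Poly_Mapping.keys_add[of m n] by (intro prod_keys_superset) auto
    also have "\<dots> = (\<Prod>v\<in>?S. \<sigma> v ^ Poly_Mapping.lookup m v) * (\<Prod>v\<in>?S. \<sigma> v ^ Poly_Mapping.lookup n v)"
      by (simp add: lookup_add power_add prod.distrib)
    also have "\<dots> = ?mon m * ?mon n"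
      by (simp add: prod_keys_superset[of ?S m] prod_keys_superset[of ?S n])
    finally show ?thesis .
  qed
  have mult: "msubst h \<sigma> (F * G) = msubst h \<sigma> F * msubst h \<sigma> G" for F G
  proof -
    have "F * G = (\<Sum>m\<in>Poly_Mapping.keys F. Poly_Mapping.single m (Poly_Mapping.lookup F m)) *
        (\<Sum>n\<in>Poly_Mapping.keys G. Poly_Mapping.single n (Poly_Mapping.lookup G n))"
      using poly_mapping_as_sum_of_singles[of F] poly_mapping_as_sum_of_singles[of G] by simp
    then have "msubst h \<sigma> (F * G) = (\<Sum>m\<in>Poly_Mapping.keys F. \<Sum>n\<in>Poly_Mapping.keys G.
        msubst h \<sigma> (Poly_Mapping.single (m + n) (Poly_Mapping.lookup F m * Poly_Mapping.lookup G n)))"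
      by (simp only: sum_product mult_single msubst_sum[OF h])
    also have "\<dots> = (\<Sum>m\<in>Poly_Mapping.keys F. \<Sum>n\<in>Poly_Mapping.keys G.
        (h (Poly_Mapping.lookup F m) * ?mon m) * (h (Poly_Mapping.lookup G n) * ?mon n))"
      by (intro sum.cong refl) (simp only: msubst_single[OF h] mon_add ring_homD[OF h] mult_ac)
    also have "\<dots> = msubst h \<sigma> F * msubst h \<sigma> G"
      by (simp add: msubst_def sum_product)
    finally show ?thesis .
  qed
  have "msubst h \<sigma> 1 = 1"
    using msubst_single[OF h, of \<sigma> 0 1] by (simp add: ring_homD[OF h])
  then show ?thesis by (simp add: ring_hom_def mult msubst_add[OF h])
qed

lemma msubst_mvar: "ring_hom h \<Longrightarrow> msubst h \<sigma> (mvar v) = \<sigma> v"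
  by (simp add: mvar_def msubst_single ring_homD)

lemma msubst_mconst: "ring_hom h \<Longrightarrow> msubst h \<sigma> (mconst c) = h c"
  by (simp add: mconst_def msubst_single)

section \<open>Multihomogeneous polynomials\<close>

lemma multihomogeneous_mult:
  assumes "multihomogeneous d r e F" "multihomogeneous d r e' G"
  shows "multihomogeneous d r (\<lambda>i. e i + e' i) (F * G)"
  unfolding multihomogeneous_def
proof
  fix m assume "m \<in> Poly_Mapping.keys (F * G)"
  then obtain a b where m: "m = a + b" "a \<in> Poly_Mapping.keys F" "b \<in> Poly_Mapping.keys G"
    using keys_mult[of F G] by blast
  have "Poly_Mapping.keys m \<subseteq> {..<r} \<times> {..d}"
    using m assms Poly_Mapping.keys_add[of a b] unfolding multihomogeneous_def by blast
  with m show "Poly_Mapping.keys m \<subseteq> {..<r} \<times> {..d} \<and>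
        (\<forall>i<r. (\<Sum>j\<le>d. Poly_Mapping.lookup m (i, j)) = e i + e' i)"
    using assms by (simp add: multihomogeneous_def lookup_add sum.distrib)
qed

lemma multihomogeneous_diff:
  assumes "multihomogeneous d r e F" "multihomogeneous d r e G"
  shows "multihomogeneous d r e (F - G)"
proof -
  have "Poly_Mapping.keys (F - G) \<subseteq> Poly_Mapping.keys F \<union> Poly_Mapping.keys G"
    by (auto simp: in_keys_iff lookup_minus)
  then show ?thesis using assms unfolding multihomogeneous_def by blast
qed

lemma multihomogeneous_mconst: "multihomogeneous d r (\<lambda>_. 0) (mconst c)"
  by (cases "c = 0") (simp_all add: multihomogeneous_def mconst_def)

lemma multihomogeneous_0: "multihomogeneous d r e 0"
  by (simp add: multihomogeneous_def)

lemma multihomogeneous_1: "multihomogeneous d r (\<lambda>_. 0) 1"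
  by (simp add: multihomogeneous_def)

lemma multihomogeneous_mvar:
  assumes "i < r" "j \<le> d"
  shows "multihomogeneous d r (\<lambda>l. if l = i then 1 else 0) (mvar (i, j))"
  using assms by (auto simp: multihomogeneous_def mvar_def lookup_single when_def intro!: sum.neutral)

lemma multihomogeneous_power:
  "multihomogeneous d r e F \<Longrightarrow> multihomogeneous d r (\<lambda>i. n * e i) (F ^ n)"
proof (induction n)
  case 0 then show ?case using multihomogeneous_1 by simp
next
  case (Suc n)
  show ?case using multihomogeneous_mult[OF Suc.prems Suc.IH[OF Suc.prems]] by simp
qed

lemma multihomogeneous_prod:
  assumes "\<And>x. x \<in> S \<Longrightarrow> multihomogeneous d r (e x) (f x)"
  shows "multihomogeneous d r (\<lambda>i. \<Sum>x\<in>S. e x i) (\<Prod>x\<in>S. f x)"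
  using assms
proof (induction S rule: infinite_finite_induct)
  case (insert x S)
  have "multihomogeneous d r (\<lambda>i. e x i + (\<Sum>x\<in>S. e x i)) (f x * (\<Prod>x\<in>S. f x))"
    by (intro multihomogeneous_mult insert) (use insert in auto)
  then show ?case using insert.hyps by simp
qed (simp_all add: multihomogeneous_1)

section \<open>Vanishing order in terms of Taylor coefficients\<close>

lemma translated_variable_power:
  fixes c :: "'k :: comm_ring_1"
  shows "(mconst c + mvar v) ^ n = (\<Sum>k\<le>n. Poly_Mapping.single (Poly_Mapping.single v k)
    (of_nat (n choose k) * c ^ (n - k)))"
proof -
  have var: "(mvar v :: (_, 'k) mpoly) ^ k = Poly_Mapping.single (Poly_Mapping.single v k) 1" for k
    by (induction k) (simp_all add: mvar_def mult_single flip: single_add)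
  have const: "(mconst c :: ('v, 'k) mpoly) ^ k = mconst (c ^ k)" for k
    by (induction k) (simp_all add: mconst_def mult_single)
  have nat: "of_nat k = (mconst (of_nat k) :: ('v, 'k) mpoly)" for k
    by (simp add: mconst_def)
  have "(mconst c + mvar v) ^ n = (mvar v + mconst c) ^ n" by (simp add: add.commute)
  also have "\<dots> = (\<Sum>k\<le>n. of_nat (n choose k) * mvar v ^ k * mconst c ^ (n - k))"
    by (rule binomial_ring)
  also have "\<dots> = (\<Sum>k\<le>n. Poly_Mapping.single (Poly_Mapping.single v k)
    (of_nat (n choose k) * c ^ (n - k)))"
    by (intro sum.cong refl) (simp only: var const nat, simp add: mconst_def mult_single del: single_of_nat)
  finally show ?thesis .
qed

lemma prod_single:
  "(\<Prod>j\<in>A. Poly_Mapping.single (f j) (c j)) =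
    Poly_Mapping.single (\<Sum>j\<in>A. f j) (\<Prod>j\<in>A. c j :: 'k :: comm_ring_1)"
  by (induction A rule: infinite_finite_induct) (simp_all add: mult_single)

lemma lookup_sum_single:
  assumes "finite A"
  shows "Poly_Mapping.lookup (\<Sum>j\<in>A. Poly_Mapping.single j (k j)) v = (if v \<in> A then k v else 0 :: nat)"
proof -
  have "Poly_Mapping.lookup (\<Sum>j\<in>A. Poly_Mapping.single j (k j)) v = (\<Sum>j\<in>A. if j = v then k v else 0)"
    unfolding lookup_sum by (intro sum.cong) (auto simp: lookup_single)
  then show ?thesis using assms by simp
qed

text \<open>Expanding the powers of the translated variables, only the choice of exponents \<open>g\<close> contributes; if
  some entry of \<open>g\<close> exceeds that of \<open>e\<close>, there is none, and a binomial coefficient is zero.\<close>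

lemma lookup_translated_monomial:
  fixes c :: "'v \<Rightarrow> 'k :: comm_ring_1"
  assumes A: "finite A" and g: "Poly_Mapping.keys g \<subseteq> A"
  shows "Poly_Mapping.lookup (mconst b * (\<Prod>j\<in>A. (mconst (c j) + mvar j) ^ e j)) g =
    b * hasse_monomial A e (Poly_Mapping.lookup g) c"
proof -
  let ?w = "\<lambda>k. b * (\<Prod>j\<in>A. of_nat (e j choose k j) * c j ^ (e j - k j))"
  let ?x = "\<lambda>k. \<Sum>j\<in>A. Poly_Mapping.single j (k j)"
  let ?K = "PiE A (\<lambda>j. {..e j})" and ?g = "restrict (Poly_Mapping.lookup g) A"
  have "mconst b * (\<Prod>j\<in>A. (mconst (c j) + mvar j) ^ e j) = (\<Sum>k\<in>?K. Poly_Mapping.single (?x k) (?w k))"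
    using A by (simp add: translated_variable_power prod_sum_PiE prod_single sum_distrib_left)
      (simp add: mconst_def mult_single)
  then have "Poly_Mapping.lookup (mconst b * (\<Prod>j\<in>A. (mconst (c j) + mvar j) ^ e j)) g =
      (\<Sum>k\<in>?K. if ?x k = g then ?w k else 0)"
    by (simp add: lookup_sum lookup_single when_def)
  also have "\<dots> = (\<Sum>k\<in>?K. if k = ?g then ?w ?g else 0)"
  proof (rule sum.cong[OF refl])
    fix k assume k: "k \<in> ?K"
    have "?x k = g \<longleftrightarrow> k = ?g"
    proof
      assume "?x k = g"
      then have "Poly_Mapping.lookup g j = k j" if "j \<in> A" for j
        using lookup_sum_single[OF A, of k j] that by simp
      then show "k = ?g" using k by (auto simp: PiE_iff extensional_def)
    next
      assume "k = ?g"
      then show "?x k = g"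
        using g by (intro poly_mapping_eqI) (auto simp: lookup_sum_single[OF A] in_keys_iff)
    qed
    then show "(if ?x k = g then ?w k else 0) = (if k = ?g then ?w ?g else 0)" by auto
  qed
  also have "\<dots> = (if ?g \<in> ?K then ?w ?g else 0)"
    using A by (simp add: finite_PiE)
  also have "\<dots> = ?w ?g"
  proof (cases "?g \<in> ?K")
    case False
    then obtain j where "j \<in> A" "e j < Poly_Mapping.lookup g j"
      by (auto simp: PiE_iff not_le)
    then have "(\<Prod>j\<in>A. of_nat (e j choose ?g j) * c j ^ (e j - ?g j)) = 0"
      using A by (intro prod_zero bexI[of _ j]) (auto simp: binomial_eq_0)
    then show ?thesis using False by simp
  qed simp
  finally show ?thesis by (simp add: hasse_monomial_def)
qed

lemma lookup_local_equation:
  fixes F :: "(nat, 'k :: field) mpoly"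
  assumes F: "F \<in> homogeneous_polys d \<delta>" and g: "Poly_Mapping.keys g \<subseteq> {1..d}"
  shows "Poly_Mapping.lookup (local_equation 0 a F) g = (\<Sum>m\<in>Poly_Mapping.keys F.
    Poly_Mapping.lookup F m *
      hasse_monomial {1..d} (Poly_Mapping.lookup m) (Poly_Mapping.lookup g) (\<lambda>j. a j / a 0))"
proof -
  let ?\<sigma> = "\<lambda>j. if j = 0 then 1 else mconst (a j / a 0) + mvar j :: (nat, 'k) mpoly"
  have "(\<Prod>v\<in>Poly_Mapping.keys m. ?\<sigma> v ^ Poly_Mapping.lookup m v) =
      (\<Prod>j\<in>{1..d}. (mconst (a j / a 0) + mvar j) ^ Poly_Mapping.lookup m j)"
    if m: "m \<in> Poly_Mapping.keys F" for m
  proof -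
    have "Poly_Mapping.keys m \<subseteq> {..d}" using F m by (auto simp: homogeneous_polys_def)
    then have "(\<Prod>v\<in>Poly_Mapping.keys m. ?\<sigma> v ^ Poly_Mapping.lookup m v) =
        (\<Prod>v\<in>{..d}. ?\<sigma> v ^ Poly_Mapping.lookup m v)"
      by (intro prod_keys_superset) auto
    also have "\<dots> = (\<Prod>v\<in>{1..d}. ?\<sigma> v ^ Poly_Mapping.lookup m v)"
      by (intro prod.mono_neutral_right) auto
    finally show ?thesis by (auto intro: prod.cong)
  qed
  then have "local_equation 0 a F = (\<Sum>m\<in>Poly_Mapping.keys F. mconst (Poly_Mapping.lookup F m) *
      (\<Prod>j\<in>{1..d}. (mconst (a j / a 0) + mvar j) ^ Poly_Mapping.lookup m j))"
    unfolding local_equation_def msubst_def by (intro sum.cong) auto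
  then show ?thesis
    by (simp only: lookup_sum lookup_translated_monomial[OF _ g] finite_atLeastAtMost)
qed

section \<open>The linear conditions as multihomogeneous polynomials\<close>

text \<open>The Taylor coefficient with exponents \<open>g\<close> of the monomial \<open>m\<close> at the \<open>i\<close>-th point, as a polynomial
  in the homogeneous coordinates of all points.  Denominators are cleared, and the last factor gives
  all conditions the same degree \<open>\<delta>\<close> in each group of variables.\<close>

definition vanishing_condition ::
  "nat \<Rightarrow> nat \<Rightarrow> nat \<Rightarrow> nat \<times> (nat \<Rightarrow> nat) \<Rightarrow> (nat \<Rightarrow>\<^sub>0 nat) \<Rightarrow> (nat \<times> nat, 'k :: comm_ring_1) mpoly" where
  "vanishing_condition d r \<delta> = (\<lambda>(i, g) m.
     mconst (of_nat (\<Prod>j\<in>{1..d}. Poly_Mapping.lookup m j choose g j)) *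
     mvar (i, 0) ^ (Poly_Mapping.lookup m 0 + (\<Sum>j\<in>{1..d}. g j)) *
     (\<Prod>j\<in>{1..d}. mvar (i, j) ^ (Poly_Mapping.lookup m j - g j)) *
     (\<Prod>l\<in>{..<r} - {i}. mvar (l, 0) ^ \<delta>))"

definition exponents :: "nat \<Rightarrow> nat \<Rightarrow> (nat \<Rightarrow>\<^sub>0 nat) set" where
  "exponents d \<delta> = {m. Poly_Mapping.keys m \<subseteq> {..d} \<and> mdeg m = \<delta>}"

lemma sum_lookup_exponent:
  assumes "m \<in> exponents d \<delta>"
  shows "Poly_Mapping.lookup m 0 + (\<Sum>j\<in>{1..d}. Poly_Mapping.lookup m j) = \<delta>"
proof -
  have "(\<Sum>j\<in>{..d}. Poly_Mapping.lookup m j) = \<delta>"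
    using assms sum_keys_superset[of "{..d}" m] by (simp add: exponents_def mdeg_def)
  then show ?thesis
    by (simp add: atMost_atLeast0 sum.atLeast_Suc_atMost)
qed

text \<open>The total degree fixes the entry at \<open>0\<close>, so passing to the chart \<open>X\<^sub>0 = 1\<close> loses nothing.\<close>

lemma exponent_eqI:
  assumes "m \<in> exponents d \<delta>" "m' \<in> exponents d \<delta>"
    and "\<And>j. j \<in> {1..d} \<Longrightarrow> Poly_Mapping.lookup m j = Poly_Mapping.lookup m' j"
  shows "m = m'"
proof (rule poly_mapping_eqI)
  fix j
  have "(\<Sum>j\<in>{1..d}. Poly_Mapping.lookup m j) = (\<Sum>j\<in>{1..d}. Poly_Mapping.lookup m' j)"
    using assms(3) by (rule sum.cong[OF refl])
  then have "Poly_Mapping.lookup m 0 = Poly_Mapping.lookup m' 0"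
    using sum_lookup_exponent[OF assms(1)] sum_lookup_exponent[OF assms(2)] by simp
  moreover have "Poly_Mapping.lookup m j = 0 \<and> Poly_Mapping.lookup m' j = 0" if "d < j"
    using assms(1,2) that by (auto simp: exponents_def in_keys_iff subset_iff)
  ultimately show "Poly_Mapping.lookup m j = Poly_Mapping.lookup m' j"
    using assms(3)[of j] by (cases "j = 0"; cases "d < j") auto
qed

lemma finite_exponents: "finite (exponents d \<delta>)"
proof (rule finite_imageD)
  let ?f = "\<lambda>m. restrict (Poly_Mapping.lookup m) {1..d}"
  have "Poly_Mapping.lookup m j \<le> \<delta>" if "m \<in> exponents d \<delta>" "j \<in> {1..d}" for m j
    using member_le_sum[of j "{1..d}" "Poly_Mapping.lookup m"] sum_lookup_exponent[OF that(1)] that(2)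
    by simp
  then have "?f ` exponents d \<delta> \<subseteq> PiE {1..d} (\<lambda>_. {..\<delta>})" by auto
  then show "finite (?f ` exponents d \<delta>)"
    by (rule finite_subset) (simp add: finite_PiE)
  show "inj_on ?f (exponents d \<delta>)"
    by (rule inj_onI, rule exponent_eqI) (auto dest: fun_cong simp: restrict_def split: if_splits)
qed

lemma multihomogeneous_vanishing_condition:
  assumes i: "i < r" and m: "m \<in> exponents d \<delta>"
  shows "multihomogeneous d r (\<lambda>_. \<delta>)
    (vanishing_condition d r \<delta> (i, g) m :: (nat \<times> nat, 'k :: field_char_0) mpoly)"
proof (cases "\<forall>j\<in>{1..d}. g j \<le> Poly_Mapping.lookup m j")
  case False
  then have "(\<Prod>j\<in>{1..d}. Poly_Mapping.lookup m j choose g j) = 0"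
    by (auto simp: not_le binomial_eq_0)
  then show ?thesis
    unfolding vanishing_condition_def prod.case
    by (simp only: of_nat_0 mconst_def single_zero mult_zero_left multihomogeneous_0)
next
  case True
  let ?v = "\<lambda>i l. if l = i then 1 else 0 :: nat"
  let ?e = "\<lambda>l. 0 + (Poly_Mapping.lookup m 0 + (\<Sum>j\<in>{1..d}. g j)) * ?v i l +
     (\<Sum>j\<in>{1..d}. (Poly_Mapping.lookup m j - g j) * ?v i l) + (\<Sum>k\<in>{..<r} - {i}. \<delta> * ?v k l)"
  have "multihomogeneous d r ?e
    (vanishing_condition d r \<delta> (i, g) m :: (nat \<times> nat, 'k) mpoly)"
    unfolding vanishing_condition_def prod.case using i
    by (intro multihomogeneous_mult multihomogeneous_mconst multihomogeneous_power
        multihomogeneous_prod multihomogeneous_mvar) auto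
  moreover have "?e l = \<delta>" if "l < r" for l
  proof (cases "l = i")
    case True
    have "(\<Sum>j\<in>{1..d}. g j) + (\<Sum>j\<in>{1..d}. Poly_Mapping.lookup m j - g j) =
        (\<Sum>j\<in>{1..d}. Poly_Mapping.lookup m j)"
      unfolding sum.distrib[symmetric]
      using \<open>\<forall>j\<in>{1..d}. g j \<le> Poly_Mapping.lookup m j\<close> by (intro sum.cong) auto
    moreover have "(\<Sum>k\<in>{..<r} - {i}. \<delta> * ?v k i) = 0" by (intro sum.neutral) auto
    ultimately show ?thesis using True sum_lookup_exponent[OF m] by simp
  next
    case False
    have "(\<Sum>k\<in>{..<r} - {i}. \<delta> * ?v k l) = (\<Sum>k\<in>{..<r} - {i}. if k = l then \<delta> else 0)"
      by (intro sum.cong) auto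
    then show ?thesis using False that by simp
  qed
  ultimately show ?thesis by (simp add: multihomogeneous_def)
qed

lemma msubst_vanishing_condition:
  assumes h: "ring_hom h"
  shows "msubst h \<sigma> (vanishing_condition d r \<delta> (i, g) m) =
     (\<Prod>j\<in>{1..d}. of_nat (Poly_Mapping.lookup m j choose g j)) *
     \<sigma> (i, 0) ^ (Poly_Mapping.lookup m 0 + (\<Sum>j\<in>{1..d}. g j)) *
     (\<Prod>j\<in>{1..d}. \<sigma> (i, j) ^ (Poly_Mapping.lookup m j - g j)) *
     (\<Prod>l\<in>{..<r} - {i}. \<sigma> (l, 0) ^ \<delta>)"
  unfolding vanishing_condition_def prod.case
  by (simp add: ring_homD[OF ring_hom_msubst[OF h]] msubst_mvar[OF h] msubst_mconst[OF h] ring_homD[OF h])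

lemma msubst_vanishing_condition_normalized:
  assumes h: "ring_hom h" and "\<And>l. l < r \<Longrightarrow> \<sigma> (l, 0) = 1" "i < r"
  shows "msubst h \<sigma> (vanishing_condition d r \<delta> (i, g) m) =
    hasse_monomial {1..d} (Poly_Mapping.lookup m) g (\<lambda>j. \<sigma> (i, j))"
  unfolding msubst_vanishing_condition[OF h] hasse_monomial_def
  using assms by (simp add: prod.distrib)

lemma ring_hom_id: "ring_hom (\<lambda>c. c)"
  by (simp add: ring_hom_def)

lemma meval_vanishing_condition:
  fixes a :: "nat \<Rightarrow> nat \<Rightarrow> 'k :: field"
  assumes i: "i < r" and a: "a i 0 \<noteq> 0" and m: "m \<in> exponents d \<delta>"
  shows "meval (\<lambda>(i, j). a i j) (vanishing_condition d r \<delta> (i, g) m) =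
    (\<Prod>l<r. a l 0 ^ \<delta>) * hasse_monomial {1..d} (Poly_Mapping.lookup m) g (\<lambda>j. a i j / a i 0)"
proof -
  let ?m = "Poly_Mapping.lookup m"
  have prod_r: "(\<Prod>l<r. a l 0 ^ \<delta>) = a i 0 ^ \<delta> * (\<Prod>l\<in>{..<r} - {i}. a l 0 ^ \<delta>)"
    using i by (intro prod.remove) auto
  show ?thesis
  proof (cases "\<forall>j\<in>{1..d}. g j \<le> ?m j")
    case False
    then obtain j where "j \<in> {1..d}" "?m j < g j" by (auto simp: not_le)
    then have "\<exists>j\<in>{1..d}. of_nat (?m j choose g j) = (0 :: 'k)"
      by (intro bexI[of _ j]) (auto simp: binomial_eq_0)
    then have "(\<Prod>j\<in>{1..d}. of_nat (?m j choose g j)) = (0 :: 'k)" by (intro prod_zero) auto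
    then show ?thesis
      unfolding msubst_vanishing_condition[OF ring_hom_id] hasse_monomial_def by (simp add: prod.distrib)
  next
    case True
    have "(\<Prod>j\<in>{1..d}. a i j ^ (?m j - g j)) =
        (\<Prod>j\<in>{1..d}. a i 0 ^ (?m j - g j) * (a i j / a i 0) ^ (?m j - g j))"
      using a by (simp flip: power_mult_distrib)
    also have "\<dots> = a i 0 ^ (\<Sum>j\<in>{1..d}. ?m j - g j) * (\<Prod>j\<in>{1..d}. (a i j / a i 0) ^ (?m j - g j))"
      by (simp add: prod.distrib power_sum)
    finally have 1: "(\<Prod>j\<in>{1..d}. a i j ^ (?m j - g j)) = \<dots>" .
    have "(\<Sum>j\<in>{1..d}. g j) + (\<Sum>j\<in>{1..d}. ?m j - g j) = (\<Sum>j\<in>{1..d}. ?m j)"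
      unfolding sum.distrib[symmetric] using True by (intro sum.cong) auto
    then have "?m 0 + (\<Sum>j\<in>{1..d}. g j) + (\<Sum>j\<in>{1..d}. ?m j - g j) = \<delta>"
      using sum_lookup_exponent[OF m] by simp
    then have 2: "a i 0 ^ (?m 0 + (\<Sum>j\<in>{1..d}. g j)) * a i 0 ^ (\<Sum>j\<in>{1..d}. ?m j - g j) = a i 0 ^ \<delta>"
      by (simp flip: power_add)
    show ?thesis
      unfolding msubst_vanishing_condition[OF ring_hom_id] hasse_monomial_def prod.case 1 prod_r 2[symmetric]
      by (simp add: prod.distrib mult_ac)
  qed
qed

section \<open>A configuration of points and a direction in which it moves\<close>

text \<open>The only place where small pairs of \<open>s\<close> and \<open>n\<close> have to be excluded.\<close>

lemma grid_large_enough: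
  assumes "1 \<le> n" "2 \<le> s" "n = 1 \<Longrightarrow> 4 \<le> s" "n = 2 \<Longrightarrow> 3 \<le> s"
  shows "2 * (n + 1) \<le> s ^ n"
proof -
  consider "n = 1" | "n = 2" | "3 \<le> n" using assms by linarith
  then show ?thesis
  proof cases
    case 1 then show ?thesis using assms by simp
  next
    case 2
    then have "3 ^ 2 \<le> s ^ 2" using assms by (intro power_mono) auto
    then show ?thesis using 2 by simp
  next
    case 3
    then have "2 * (n + 1) \<le> 2 ^ n" by (induction n rule: dec_induct) auto
    also have "\<dots> \<le> s ^ n" using assms by (intro power_mono) auto
    finally show ?thesis .
  qed
qed

text \<open>The origin and the unit vectors occupy at most \<open>n + 1\<close> points of the grid, so the inequality leaves room
  for \<open>n + 1\<close> further ones.\<close>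

lemma special_grid_points:
  assumes n: "1 \<le> n" "2 * (n + 1) \<le> s ^ n"
  obtains Q :: "nat \<Rightarrow> nat \<Rightarrow> nat" where "inj_on Q {1..Suc n}"
    and "\<And>i. i \<in> {1..Suc n} \<Longrightarrow> Q i \<in> grid {1..n} s - insert (restrict (\<lambda>_. 0) {1..n})
      ((\<lambda>l. (restrict (\<lambda>_. 0) {1..n})(l := 1)) ` {1..n})"
proof -
  let ?B = "insert (restrict (\<lambda>_. 0) {1..n}) ((\<lambda>l. (restrict (\<lambda>_. 0) {1..n})(l := 1)) ` {1..n}) :: (nat \<Rightarrow> nat) set"
  have fin: "finite (grid {1..n} s)" by (simp add: finite_PiE)
  have card: "card (grid {1..n} s) = s ^ n" by (simp add: card_PiE)
  have "card ?B \<le> Suc (card ((\<lambda>l. (restrict (\<lambda>_. 0) {1..n})(l := 1)) ` {1..n} :: (nat \<Rightarrow> nat) set))"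
    by (rule card_insert_le_m1) auto
  also have "\<dots> \<le> Suc n" using card_image_le[of "{1..n}"] by simp
  finally have "card {1..Suc n} \<le> card (grid {1..n} s - ?B)"
    using diff_card_le_card_Diff[of ?B "grid {1..n} s"] n card by simp
  then obtain Q where "Q ` {1..Suc n} \<subseteq> grid {1..n} s - ?B" "inj_on Q {1..Suc n}"
    using card_le_inj[of "{1..Suc n}" "grid {1..n} s - ?B"] fin by auto
  then show ?thesis using that by blast
qed

lemma coeffs_mult_of_high_order:
  fixes h x :: "'k :: comm_ring_1 poly"
  assumes "\<And>l. l < N \<Longrightarrow> coeff x l = 0"
  shows "coeff (h * x) N = coeff h 0 * coeff x N"
    and "coeff (h * x) (Suc N) = coeff h 0 * coeff x (Suc N) + coeff h 1 * coeff x N"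
proof -
  have "monom 1 N dvd x" using assms by (simp add: monom_1_dvd_iff')
  then obtain w where w: "x = monom 1 N * w" by blast
  have xw: "coeff x N = coeff w 0" "coeff x (Suc N) = coeff w 1" by (simp_all add: w coeff_monom_mult)
  have hx: "h * x = monom 1 N * (h * w)" by (simp add: w)
  have "coeff (h * w) 0 = coeff h 0 * coeff w 0" "coeff (h * w) 1 = coeff h 0 * coeff w 1 + coeff h 1 * coeff w 0"
    by (simp_all add: coeff_mult)
  then show "coeff (h * x) N = coeff h 0 * coeff x N"
    and "coeff (h * x) (Suc N) = coeff h 0 * coeff x (Suc N) + coeff h 1 * coeff x N"
    by (simp_all add: hx xw coeff_monom_mult)
qed

lemma coeff_0_hasse_monomial_line:
  "coeff (hasse_monomial X e g (\<lambda>j. [:p j, v j:])) 0 = hasse_monomial X e g (p :: _ \<Rightarrow> 'k :: field_char_0)"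
  by (simp add: hasse_monomial_def poly_prod flip: poly_0_coeff_0)

text \<open>The motion of a point with velocity \<open>v\<close> enters the first-order conditions through Taylor
  coefficients of the next order.\<close>

lemma coeff_1_hasse_monomial_line:
  fixes p :: "'v \<Rightarrow> 'k :: field_char_0"
  assumes X: "finite X"
  shows "coeff (hasse_monomial X e g (\<lambda>j. [:p j, v j:])) 1 =
    (\<Sum>i\<in>X. v i * (of_nat (Suc (g i)) * hasse_monomial X e (g(i := Suc (g i))) p))"
proof -
  let ?f = "\<lambda>j. of_nat (e j choose g j) * [:p j, v j:] ^ (e j - g j)"
  have "coeff (hasse_monomial X e g (\<lambda>j. [:p j, v j:])) 1 = poly (pderiv (\<Prod>j\<in>X. ?f j)) 0"
    by (simp add: hasse_monomial_def poly_0_coeff_0 coeff_pderiv)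
  also have "\<dots> = (\<Sum>i\<in>X. (\<Prod>j\<in>X - {i}. poly (?f j) 0) * poly (pderiv (?f i)) 0)"
    by (simp add: pderiv_prod poly_sum poly_prod)
  also have "\<dots> = (\<Sum>i\<in>X. v i * (of_nat (Suc (g i)) * hasse_monomial X e (g(i := Suc (g i))) p))"
  proof (rule sum.cong[OF refl])
    fix i assume i: "i \<in> X"
    have binom: "of_nat (Suc (g i)) * of_nat (e i choose Suc (g i)) =
        (of_nat (e i choose g i) * of_nat (e i - g i) :: 'k)"
      using binomial_absorption[of "g i" "e i"] binomial_absorb_comp[of "e i" "g i"]
      by (simp only: mult.commute flip: of_nat_mult)
    have "poly (pderiv (?f i)) 0 = of_nat (e i choose g i) * of_nat (e i - g i) * p i ^ (e i - Suc (g i)) * v i"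
      by (simp add: of_nat_poly pderiv_smult pderiv_power pderiv_pCons)
    also have "\<dots> = v i * (of_nat (Suc (g i)) * (of_nat (e i choose Suc (g i)) * p i ^ (e i - Suc (g i))))"
      unfolding binom[symmetric] by (simp add: mult_ac)
    finally have 1: "poly (pderiv (?f i)) 0 = \<dots>" .
    have "hasse_monomial X e (g(i := Suc (g i))) p =
        of_nat (e i choose Suc (g i)) * p i ^ (e i - Suc (g i)) * (\<Prod>j\<in>X - {i}. poly (?f j) 0)"
      unfolding hasse_monomial_def using X i by (subst prod.remove[of X i]) auto
    then show "(\<Prod>j\<in>X - {i}. poly (?f j) 0) * poly (pderiv (?f i)) 0 =
        v i * (of_nat (Suc (g i)) * hasse_monomial X e (g(i := Suc (g i))) p)"
      unfolding 1 by (simp add: mult_ac)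
  qed
  finally show ?thesis .
qed

text \<open>A nonzero solution over the polynomials in \<open>t\<close> starts with terms \<open>x0 * t^N + x1 * t^(N + 1)\<close>, where
  \<open>x0 \<noteq> 0\<close>, and comparing coefficients of \<open>t^N\<close> and \<open>t^(N + 1)\<close> contradicts \<open>first_order_rigidity\<close>.  The last
  variable plays the role of \<open>z\<close>.\<close>

lemma moving_points_impose_independent_conditions:
  fixes d s \<delta> \<mu> :: nat
  assumes d: "2 \<le> d" and s: "2 \<le> s" "d = 2 \<longrightarrow> 4 \<le> s" "d = 3 \<longrightarrow> 3 \<le> s"
    and \<mu>: "1 \<le> \<mu>" and \<delta>: "\<delta> \<le> s * \<mu>"
  obtains p v :: "nat \<Rightarrow> nat \<Rightarrow> 'k :: field_char_0"
  where "\<And>i. p i 0 = 1" "\<And>i. v i 0 = 0" "\<And>i j. d < j \<Longrightarrow> p i j = 0 \<and> v i j = 0"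
    and "\<forall>x. (\<forall>i g. i < s ^ d \<and> (\<Sum>j\<in>{1..d}. g j) < \<mu> \<longrightarrow>
        (\<Sum>m\<in>exponents d \<delta>.
          hasse_monomial {1..d} (Poly_Mapping.lookup m) g (\<lambda>j. [:p i j, v i j:]) * x m) = 0) \<longrightarrow>
      (\<forall>m\<in>exponents d \<delta>. x m = 0)"
proof -
  define n where "n = d - 1"
  have dn: "d = Suc n" and n: "1 \<le> n" using d by (auto simp: n_def)
  let ?Y = "{1..n}" and ?J = "exponents d \<delta>"
  have Yd: "insert d ?Y = {1..d}" using dn n by auto
  have "2 * (n + 1) \<le> s ^ n" using n s dn by (intro grid_large_enough) auto
  then obtain Q :: "nat \<Rightarrow> nat \<Rightarrow> nat" where Q_inj: "inj_on Q {1..Suc n}"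
    and Q: "\<And>i. i \<in> {1..Suc n} \<Longrightarrow> Q i \<in> grid ?Y s - insert (restrict (\<lambda>_. 0) ?Y)
      ((\<lambda>l. (restrict (\<lambda>_. 0) ?Y)(l := 1)) ` ?Y)"
    using special_grid_points[OF n] by blast
  interpret grid_system ?Y d ?J Poly_Mapping.lookup s \<mu> Q
  proof
    show "(\<Sum>i\<in>?Y. Poly_Mapping.lookup m i) + Poly_Mapping.lookup m d \<le> s * \<mu>" if "m \<in> ?J" for m
    proof -
      have "(\<Sum>i\<in>?Y. Poly_Mapping.lookup m i) + Poly_Mapping.lookup m d =
          (\<Sum>i\<in>insert d ?Y. Poly_Mapping.lookup m i)" using dn by simp
      then show ?thesis using sum_lookup_exponent[OF that] \<delta> unfolding Yd by linarith
    qed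
    show "inj_on Q (insert d ?Y)" using Q_inj Yd dn by simp
    have Yn: "insert d ?Y = {1..Suc n}" using Yd dn by simp
    show "Q i \<in> grid ?Y s" if "i \<in> insert d ?Y" for i using Q that unfolding Yn by blast
    show "Q i \<noteq> restrict (\<lambda>_. 0) ?Y" if "i \<in> insert d ?Y" for i
      using Q[of i] that unfolding Yn by auto
    show "Q i \<noteq> (restrict (\<lambda>_. 0) ?Y)(l := 1)" if "i \<in> insert d ?Y" "l \<in> ?Y" for i l
      using Q[of i] that unfolding Yn by auto
  qed (use s \<mu> dn finite_exponents in auto)
  have "finite (grid ?Y s \<times> {..<s})" by (simp add: finite_PiE)
  moreover have "card (grid ?Y s \<times> {..<s}) = s ^ d"
    by (simp add: card_cartesian_product card_PiE dn)
  ultimately obtain idx where idx: "bij_betw idx {0..<s ^ d} (grid ?Y s \<times> {..<s})"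
    using ex_bij_betw_nat_finite by metis
  define p :: "nat \<Rightarrow> nat \<Rightarrow> 'k"
    where "p i j = (if j = 0 then 1 else if j \<le> d then point (fst (idx i)) (snd (idx i)) j else 0)" for i j
  define v :: "nat \<Rightarrow> nat \<Rightarrow> 'k"
    where "v i j = (if j \<in> ?Y \<and> fst (idx i) = Q j \<and> snd (idx i) = 0 then 1 else 0)" for i j
  show ?thesis
  proof (rule that)
    show "p i 0 = 1" "v i 0 = 0" for i by (simp_all add: p_def v_def)
    show "p i j = 0 \<and> v i j = 0" if "d < j" for i j using that dn by (simp add: p_def v_def)
    show "\<forall>x. (\<forall>i g. i < s ^ d \<and> (\<Sum>j\<in>{1..d}. g j) < \<mu> \<longrightarrow>
        (\<Sum>m\<in>?J. hasse_monomial {1..d} (Poly_Mapping.lookup m) g (\<lambda>j. [:p i j, v i j:]) * x m) = 0) \<longrightarrow>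
      (\<forall>m\<in>?J. x m = 0)"
    proof (intro allI impI ballI, rule ccontr)
      fix x :: "(nat \<Rightarrow>\<^sub>0 nat) \<Rightarrow> 'k poly" and m
      assume ker: "\<forall>i g. i < s ^ d \<and> (\<Sum>j\<in>{1..d}. g j) < \<mu> \<longrightarrow>
          (\<Sum>m\<in>?J. hasse_monomial {1..d} (Poly_Mapping.lookup m) g (\<lambda>j. [:p i j, v i j:]) * x m) = 0"
        and m: "m \<in> ?J"
      assume "x m \<noteq> 0"
      then have "\<exists>N. \<exists>m\<in>?J. coeff (x m) N \<noteq> 0" using m by (auto simp: poly_eq_iff)
      then obtain N where N: "\<exists>m\<in>?J. coeff (x m) N \<noteq> 0" and
        least: "\<And>l. l < N \<Longrightarrow> \<not> (\<exists>m\<in>?J. coeff (x m) l \<noteq> 0)"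
        using exists_least_iff[of "\<lambda>N. \<exists>m\<in>?J. coeff (x m) N \<noteq> 0"] by blast
      define x0 where "x0 m = coeff (x m) N" for m
      define x1 where "x1 m = coeff (x m) (Suc N)" for m
      have rows: "taylor x0 g (point \<kappa> a) = 0 \<and>
          taylor x1 g (point \<kappa> a) + (\<Sum>i\<in>?Y. (if \<kappa> = Q i \<and> a = 0 then 1 else 0) *
            (of_nat (Suc (g i)) * taylor x0 (g(i := Suc (g i))) (point \<kappa> a))) = 0"
        if \<kappa>: "\<kappa> \<in> grid ?Y s" and a: "a < s" and g: "(\<Sum>j\<in>insert d ?Y. g j) < \<mu>" for \<kappa> a g
      proof -
        have "(\<kappa>, a) \<in> idx ` {0..<s ^ d}" using idx \<kappa> a by (auto simp: bij_betw_def)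
        then obtain i where i: "i < s ^ d" "idx i = (\<kappa>, a)" by auto
        let ?h = "\<lambda>m. hasse_monomial {1..d} (Poly_Mapping.lookup m) g (\<lambda>j. [:p i j, v i j:])"
        have p: "hasse_monomial {1..d} e g (p i) = hasse_monomial {1..d} e g (point \<kappa> a)" for e g
          using i by (intro hasse_monomial_cong) (auto simp: p_def)
        have h0: "coeff (?h m) 0 = hasse_monomial {1..d} (Poly_Mapping.lookup m) g (point \<kappa> a)" for m
          by (simp only: coeff_0_hasse_monomial_line p)
        have h1: "coeff (?h m) 1 = (\<Sum>l\<in>?Y. (if \<kappa> = Q l \<and> a = 0 then 1 else 0) * (of_nat (Suc (g l)) *
            hasse_monomial {1..d} (Poly_Mapping.lookup m) (g(l := Suc (g l))) (point \<kappa> a)))" for m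
        proof -
          have "coeff (?h m) 1 = (\<Sum>l\<in>{1..d}. v i l * (of_nat (Suc (g l)) *
            hasse_monomial {1..d} (Poly_Mapping.lookup m) (g(l := Suc (g l))) (point \<kappa> a)))"
            by (simp only: coeff_1_hasse_monomial_line[OF finite_atLeastAtMost] p)
          also have "\<dots> = (\<Sum>l\<in>?Y. v i l * (of_nat (Suc (g l)) *
            hasse_monomial {1..d} (Poly_Mapping.lookup m) (g(l := Suc (g l))) (point \<kappa> a)))"
            using dn by (intro sum.mono_neutral_right) (auto simp: v_def)
          also have "\<dots> = (\<Sum>l\<in>?Y. (if \<kappa> = Q l \<and> a = 0 then 1 else 0) * (of_nat (Suc (g l)) *
            hasse_monomial {1..d} (Poly_Mapping.lookup m) (g(l := Suc (g l))) (point \<kappa> a)))"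
            using i by (intro sum.cong) (auto simp: v_def)
          finally show ?thesis .
        qed
        have "(\<Sum>m\<in>?J. ?h m * x m) = 0" using ker i(1) g unfolding Yd by blast
        then have row: "(\<Sum>m\<in>?J. coeff (?h m * x m) l) = 0" for l
          by (simp only: coeff_sum[symmetric] coeff_0)
        have "(\<Sum>m\<in>?J. coeff (?h m) 0 * x0 m) = (\<Sum>m\<in>?J. coeff (?h m * x m) N)"
          unfolding x0_def using least by (intro sum.cong coeffs_mult_of_high_order(1)[symmetric]) auto
        then have 0: "taylor x0 g (point \<kappa> a) = 0"
          unfolding row h0 taylor_def Yd by (simp add: mult.commute)
        have "(\<Sum>m\<in>?J. coeff (?h m) 0 * x1 m + coeff (?h m) 1 * x0 m) =
            (\<Sum>m\<in>?J. coeff (?h m * x m) (Suc N))"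
          unfolding x0_def x1_def
          using least by (intro sum.cong coeffs_mult_of_high_order(2)[symmetric]) auto
        then have "taylor x1 g (point \<kappa> a) + (\<Sum>m\<in>?J. coeff (?h m) 1 * x0 m) = 0"
          unfolding row h0 taylor_def Yd sum.distrib by (simp add: mult.commute)
        also have "(\<Sum>m\<in>?J. coeff (?h m) 1 * x0 m) =
            (\<Sum>i\<in>?Y. (if \<kappa> = Q i \<and> a = 0 then 1 else 0) *
            (of_nat (Suc (g i)) * taylor x0 (g(i := Suc (g i))) (point \<kappa> a)))"
          unfolding h1 taylor_def Yd sum_distrib_left sum_distrib_right
          by (subst sum.swap) (simp only: mult_ac)
        finally show ?thesis using 0 by blast
      qed
      have "x0 m = 0" if "m \<in> ?J" for m
      proof (rule first_order_rigidity[of x0 x1])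
        show "m = m'" if "m \<in> ?J" "m' \<in> ?J"
          "\<forall>i\<in>insert d ?Y. Poly_Mapping.lookup m i = Poly_Mapping.lookup m' i" for m m'
          using that unfolding Yd by (intro exponent_eqI) auto
      qed (use rows that in blast)+
      then show False using N by (simp add: x0_def)
    qed
  qed
qed

section \<open>Open sets of point configurations\<close>

lemma ring_hom_const_poly: "ring_hom (\<lambda>c :: 'k :: comm_ring_1. [:c:])"
  by (simp add: ring_hom_def one_pCons)

lemma poly_msubst_line:
  fixes F :: "('v, 'k :: comm_ring_1) mpoly"
  shows "poly (msubst (\<lambda>c. [:c:]) (\<lambda>x. [:a x, b x:]) F) t = meval (\<lambda>x. a x + t * b x) F"
  by (simp add: msubst_def poly_sum poly_prod mult.commute)

lemma exists_nonroot:
  fixes q :: "'k :: {idom, ring_char_0} poly"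
  assumes "q \<noteq> 0"
  obtains t where "poly q t \<noteq> 0"
proof -
  have "{x. poly q x = 0} \<noteq> UNIV" using poly_roots_finite[OF assms] infinite_UNIV_char_0 by metis
  then show ?thesis using that by blast
qed

text \<open>It suffices that some choice of representatives gives a nonzero value; for multihomogeneous \<open>P\<close> the
  choice is immaterial.\<close>

definition nonvanishing_locus ::
  "nat \<Rightarrow> nat \<Rightarrow> (nat \<times> nat, 'k :: field) mpoly \<Rightarrow> (nat \<Rightarrow> (nat \<Rightarrow> 'k) set) set" where
  "nonvanishing_locus d r P =
     {p \<in> proj_power d r. \<exists>a. (\<forall>i<r. a i \<in> p i) \<and> meval (\<lambda>(i, j). a i j) P \<noteq> 0}"

lemma zariski_open_nonvanishing_locus:
  assumes "multihomogeneous d r e P"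
  shows "zariski_open d r (nonvanishing_locus d r P)"
  unfolding zariski_open_def zariski_closed_def
proof (intro conjI exI[of _ "{P}"])
  show "\<forall>F\<in>{P}. \<exists>e. multihomogeneous d r e F" using assms by blast
qed (auto simp: nonvanishing_locus_def)

lemma proj_space_memD:
  assumes "p \<in> proj_space d" "a \<in> p"
  shows "a \<in> hom_coords d"
  using assms by (auto simp: proj_space_def proportional_def elim!: quotientE)

lemma nonvanishing_locusI:
  assumes a: "\<And>i. i < r \<Longrightarrow> a i \<in> hom_coords d" and P: "meval (\<lambda>(i, j). a i j) P \<noteq> 0"
  shows "restrict (\<lambda>i. proportional d `` {a i}) {..<r} \<in> nonvanishing_locus d r P"
    and "\<And>i. i < r \<Longrightarrow> a i \<in> proportional d `` {a i}"
proof -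
  show self: "a i \<in> proportional d `` {a i}" if "i < r" for i
    using a[OF that] by (auto simp: proportional_def intro: exI[of _ 1])
  have "restrict (\<lambda>i. proportional d `` {a i}) {..<r} \<in> proj_power d r"
    using a by (auto simp: proj_power_def proj_space_def intro: quotientI)
  with self P show "restrict (\<lambda>i. proportional d `` {a i}) {..<r} \<in> nonvanishing_locus d r P"
    by (auto simp: nonvanishing_locus_def intro!: exI[of _ a])
qed

text \<open>The line through a configuration where \<open>P\<close> does not vanish and one in \<open>V\<close> contains a configuration
  with both properties, since a product of two nonzero polynomials in one variable has a nonroot.
  The condition on the coordinates \<open>b i 0\<close> guarantees that its members are points of projective space.\<close>

lemma nonvanishing_locus_meets_open:
  fixes P :: "(nat \<times> nat, 'k :: field_char_0) mpoly"
  assumes a: "\<And>i j. d < j \<Longrightarrow> a i j = 0" "meval (\<lambda>(i, j). a i j) P \<noteq> 0"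
    and P: "\<And>b i. meval (\<lambda>(i, j). b i j) P \<noteq> 0 \<Longrightarrow> i < r \<Longrightarrow> b i 0 \<noteq> 0"
    and V: "zariski_open d r V" "V \<noteq> {}"
  shows "nonvanishing_locus d r P \<inter> V \<noteq> {}"
proof -
  obtain S where S: "proj_power d r - V = {p \<in> proj_power d r.
      \<forall>F\<in>S. \<forall>a. (\<forall>i<r. a i \<in> p i) \<longrightarrow> meval (\<lambda>(i, j). a i j) F = 0}" and V_sub: "V \<subseteq> proj_power d r"
    using V(1) by (auto simp: zariski_open_def zariski_closed_def)
  obtain p where "p \<in> V" using V(2) by blast
  then have p: "p \<in> proj_power d r" "p \<notin> proj_power d r - V" using V_sub by auto
  then obtain F b where F: "F \<in> S" and b: "\<And>i. i < r \<Longrightarrow> b i \<in> p i" "meval (\<lambda>(i, j). b i j) F \<noteq> 0"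
    unfolding S by blast
  have b0: "b i j = 0" if "i < r" "d < j" for i j
    using proj_space_memD[of "p i" d "b i"] p(1) b(1)[OF that(1)] that
    by (auto simp: proj_power_def hom_coords_def)
  define line where "line G = msubst (\<lambda>c. [:c:]) (\<lambda>x. [:(\<lambda>(i, j). a i j) x, (\<lambda>(i, j). b i j - a i j) x:]) G"
    for G :: "(nat \<times> nat, 'k) mpoly"
  have line: "poly (line G) t = meval (\<lambda>(i, j). a i j + t * (b i j - a i j)) G" for G t
    unfolding line_def poly_msubst_line by (simp add: case_prod_unfold)
  have "poly (line P) 0 \<noteq> 0" using a(2) by (simp add: line)
  moreover have "poly (line F) 1 \<noteq> 0" using b(2) by (simp add: line)
  ultimately have "line P * line F \<noteq> 0" by auto
  then obtain t where t: "poly (line P * line F) t \<noteq> 0" by (rule exists_nonroot)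
  define c where "c i j = a i j + t * (b i j - a i j)" for i j
  have cP: "meval (\<lambda>(i, j). c i j) P \<noteq> 0" and cF: "meval (\<lambda>(i, j). c i j) F \<noteq> 0"
    using t by (auto simp: line c_def)
  have c: "c i \<in> hom_coords d" if "i < r" for i
    using P[OF cP that] a(1) b0[OF that] by (auto simp: hom_coords_def c_def)
  let ?q = "restrict (\<lambda>i. proportional d `` {c i}) {..<r}"
  have q: "?q \<in> nonvanishing_locus d r P" by (rule nonvanishing_locusI(1)[OF c cP])
  have "\<forall>i<r. c i \<in> ?q i" using nonvanishing_locusI(2)[OF c cP] by simp
  then have "?q \<notin> proj_power d r - V" unfolding S using F cF by blast
  then have "?q \<in> V" using q by (simp add: nonvanishing_locus_def)
  then show ?thesis using q by blast
qed

text \<open>The polynomial is the product of the pivots with the coordinates \<open>X\<^sub>i\<^sub>,\<^sub>0\<close>; the latter keep all points in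
  the chart in which the conditions were written down.\<close>

lemma generic_vanishing_polynomial:
  fixes d s r \<delta> \<mu> :: nat
  assumes d: "2 \<le> d" and s: "2 \<le> s" "d = 2 \<longrightarrow> 4 \<le> s" "d = 3 \<longrightarrow> 3 \<le> s"
    and \<mu>: "1 \<le> \<mu>" and \<delta>: "\<delta> \<le> s * \<mu>" and r: "r = s ^ d"
  obtains P :: "(nat \<times> nat, 'k :: field_char_0) mpoly" and e a
  where "multihomogeneous d r e P"
    and "\<And>i j. d < j \<Longrightarrow> a i j = 0" "meval (\<lambda>(i, j). a i j) P \<noteq> 0"
    and "\<And>b i. meval (\<lambda>(i, j). b i j) P \<noteq> 0 \<Longrightarrow> i < r \<Longrightarrow> b i 0 \<noteq> 0"
    and "\<And>b F. meval (\<lambda>(i, j). b i j) P \<noteq> 0 \<Longrightarrow> F \<in> homogeneous_polys d \<delta> \<Longrightarrow>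
      \<forall>i<r. \<forall>m\<in>Poly_Mapping.keys (local_equation 0 (b i) F). \<mu> \<le> mdeg m \<Longrightarrow> F = 0"
proof -
  obtain p v :: "nat \<Rightarrow> nat \<Rightarrow> 'k" where p0: "\<And>i. p i 0 = 1" and v0: "\<And>i. v i 0 = 0"
    and pv: "\<And>i j. d < j \<Longrightarrow> p i j = 0 \<and> v i j = 0"
    and rigid: "\<forall>x. (\<forall>i g. i < s ^ d \<and> (\<Sum>j\<in>{1..d}. g j) < \<mu> \<longrightarrow>
        (\<Sum>m\<in>exponents d \<delta>.
          hasse_monomial {1..d} (Poly_Mapping.lookup m) g (\<lambda>j. [:p i j, v i j:]) * x m) = 0) \<longrightarrow>
      (\<forall>m\<in>exponents d \<delta>. x m = 0)"
    by (rule moving_points_impose_independent_conditions[OF d s \<mu> \<delta>, where 'k='k]) blast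
  let ?J = "exponents d \<delta>" and ?I = "{(i, g :: nat \<Rightarrow> nat). i < r \<and> (\<Sum>j\<in>{1..d}. g j) < \<mu>}"
  let ?M = "vanishing_condition d r \<delta> :: _ \<Rightarrow> _ \<Rightarrow> (nat \<times> nat, 'k) mpoly"
  define \<sigma> where "\<sigma> = (\<lambda>(i, j). [:p i j, v i j:])"
  let ?\<phi> = "msubst (\<lambda>c. [:c:]) \<sigma>"
  have \<phi>: "ring_hom ?\<phi>" by (rule ring_hom_msubst[OF ring_hom_const_poly])
  have \<sigma>0: "\<sigma> (i, 0) = 1" for i by (simp add: \<sigma>_def p0 v0 one_pCons)
  have "(\<exists>x. (\<exists>m\<in>?J. x m \<noteq> 0) \<and> (\<forall>c\<in>?I. (\<Sum>m\<in>?J. ?\<phi> (?M c m) * x m) = 0)) \<or>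
    (\<exists>D e'. multihomogeneous d r e' D \<and> ?\<phi> D \<noteq> 0 \<and>
      (\<forall>\<psi> :: (nat \<times> nat, 'k) mpoly \<Rightarrow> 'k. ring_hom \<psi> \<and> \<psi> D \<noteq> 0 \<longrightarrow>
      (\<forall>y. (\<forall>c\<in>?I. (\<Sum>m\<in>?J. \<psi> (?M c m) * y m) = 0) \<longrightarrow> (\<forall>m\<in>?J. y m = 0))))"
    by (rule kernel_or_generic_injectivity[OF \<phi>, where e="\<lambda>_. \<delta>"])
       (auto intro: multihomogeneous_1 multihomogeneous_mult multihomogeneous_diff
          finite_exponents multihomogeneous_vanishing_condition)
  then show ?thesis
  proof (elim disjE exE conjE)
    fix x assume nz: "\<exists>m\<in>?J. x m \<noteq> 0" and x: "\<forall>c\<in>?I. (\<Sum>m\<in>?J. ?\<phi> (?M c m) * x m) = 0"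
    have "\<forall>i g. i < s ^ d \<and> (\<Sum>j\<in>{1..d}. g j) < \<mu> \<longrightarrow>
        (\<Sum>m\<in>?J. hasse_monomial {1..d} (Poly_Mapping.lookup m) g (\<lambda>j. [:p i j, v i j:]) * x m) = 0"
    proof (intro allI impI, elim conjE)
      fix i and g :: "nat \<Rightarrow> nat" assume i: "i < s ^ d" and g: "(\<Sum>j\<in>{1..d}. g j) < \<mu>"
      have "?\<phi> (?M (i, g) m) = hasse_monomial {1..d} (Poly_Mapping.lookup m) g (\<lambda>j. [:p i j, v i j:])" for m
        using i r \<sigma>0 msubst_vanishing_condition_normalized[of "\<lambda>c. [:c:]" r \<sigma> i d \<delta> g m]
        by (simp add: ring_hom_const_poly) (simp add: \<sigma>_def)
      moreover have "(i, g) \<in> ?I" using i g r by simp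
      ultimately show "(\<Sum>m\<in>?J. hasse_monomial {1..d} (Poly_Mapping.lookup m) g (\<lambda>j. [:p i j, v i j:]) * x m) = 0"
        using x by fastforce
    qed
    with rigid nz show ?thesis by blast
  next
    fix D e' assume D: "multihomogeneous d r e' D" "?\<phi> D \<noteq> 0"
      and inj: "\<forall>\<psi> :: (nat \<times> nat, 'k) mpoly \<Rightarrow> 'k. ring_hom \<psi> \<and> \<psi> D \<noteq> 0 \<longrightarrow>
      (\<forall>y. (\<forall>c\<in>?I. (\<Sum>m\<in>?J. \<psi> (?M c m) * y m) = 0) \<longrightarrow> (\<forall>m\<in>?J. y m = 0))"
    \<comment> \<open>At the configurations \<open>p + t * v\<close> the extra factor is one.\<close>
    define P where "P = D * (\<Prod>i<r. mvar (i, 0))"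
    have "?\<phi> P = ?\<phi> D"
      by (simp add: P_def ring_homD[OF \<phi>] msubst_mvar[OF ring_hom_const_poly] \<sigma>0)
    then obtain t where t: "poly (?\<phi> P) t \<noteq> 0" using D exists_nonroot by metis
    have meval_P: "meval (\<lambda>(i, j). b i j) P = meval (\<lambda>(i, j). b i j) D * (\<Prod>i<r. b i 0)" for b
      by (simp add: P_def ring_homD[OF ring_hom_msubst[OF ring_hom_id]] msubst_mvar[OF ring_hom_id])
    show ?thesis
    proof (rule that)
      show "multihomogeneous d r (\<lambda>l. e' l + (\<Sum>i<r. if l = i then 1 else 0)) P"
        unfolding P_def by (intro multihomogeneous_mult multihomogeneous_prod multihomogeneous_mvar D) auto
      show "p i j + t * v i j = 0" if "d < j" for i j using pv[OF that] by simp
      have "(\<lambda>(i, j). [:p i j, v i j:]) = (\<lambda>x. [:(\<lambda>(i, j). p i j) x, (\<lambda>(i, j). v i j) x:])"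
        by (simp add: fun_eq_iff)
      then show "meval (\<lambda>(i, j). p i j + t * v i j) P \<noteq> 0"
        using t unfolding \<sigma>_def by (simp add: poly_msubst_line case_prod_unfold)
      show "b i 0 \<noteq> 0" if "meval (\<lambda>(i, j). b i j) P \<noteq> 0" "i < r" for b i
        using that by (auto simp: meval_P)
    next
      fix b and F :: "(nat, 'k) mpoly"
      assume bP: "meval (\<lambda>(i, j). b i j) P \<noteq> 0" and F: "F \<in> homogeneous_polys d \<delta>"
        and van: "\<forall>i<r. \<forall>m\<in>Poly_Mapping.keys (local_equation 0 (b i) F). \<mu> \<le> mdeg m"
      have keys: "Poly_Mapping.keys F \<subseteq> ?J" using F by (auto simp: homogeneous_polys_def exponents_def)
      have b0: "b i 0 \<noteq> 0" if "i < r" for i using bP that by (auto simp: meval_P)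
      have "(\<Sum>m\<in>?J. meval (\<lambda>(i, j). b i j) (?M (i, g) m) * Poly_Mapping.lookup F m) = 0"
        if i: "i < r" and g: "(\<Sum>j\<in>{1..d}. g j) < \<mu>" for i g
      proof -
        let ?h = "\<lambda>m. hasse_monomial {1..d} (Poly_Mapping.lookup m) g (\<lambda>j. b i j / b i 0)"
        define \<gamma> where "\<gamma> = (\<Sum>j\<in>{1..d}. Poly_Mapping.single j (g j))"
        have lookup: "Poly_Mapping.lookup \<gamma> j = (if j \<in> {1..d} then g j else 0)" for j
          unfolding \<gamma>_def by (rule lookup_sum_single) simp
        then have \<gamma>_keys: "Poly_Mapping.keys \<gamma> \<subseteq> {1..d}" by (auto simp: in_keys_iff split: if_splits)
        have "mdeg \<gamma> = (\<Sum>j\<in>{1..d}. Poly_Mapping.lookup \<gamma> j)"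
          unfolding mdeg_def by (rule sum_keys_superset[OF _ \<gamma>_keys]) simp
        also have "\<dots> = (\<Sum>j\<in>{1..d}. g j)" by (rule sum.cong) (auto simp: lookup)
        finally have "\<gamma> \<notin> Poly_Mapping.keys (local_equation 0 (b i) F)" using van i g by (metis not_le)
        then have "0 = Poly_Mapping.lookup (local_equation 0 (b i) F) \<gamma>" by (simp add: in_keys_iff)
        also have "\<dots> = (\<Sum>m\<in>Poly_Mapping.keys F. Poly_Mapping.lookup F m * ?h m)"
          unfolding lookup_local_equation[OF F \<gamma>_keys]
          by (intro sum.cong refl arg_cong2[where f="(*)"] hasse_monomial_cong) (auto simp: lookup)
        also have "\<dots> = (\<Sum>m\<in>?J. Poly_Mapping.lookup F m * ?h m)"
          using keys by (intro sum.mono_neutral_left finite_exponents) (auto simp: in_keys_iff)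
        finally have "(\<Sum>m\<in>?J. Poly_Mapping.lookup F m * ?h m) = 0" by simp
        moreover have "(\<Sum>m\<in>?J. meval (\<lambda>(i, j). b i j) (?M (i, g) m) * Poly_Mapping.lookup F m) =
            (\<Sum>m\<in>?J. (\<Prod>l<r. b l 0 ^ \<delta>) * (Poly_Mapping.lookup F m * ?h m))"
          by (intro sum.cong refl)
             (simp only: meval_vanishing_condition[of i r b, OF i b0[OF i]] mult_ac)
        ultimately show ?thesis by (simp flip: sum_distrib_left)
      qed
      moreover have "meval (\<lambda>(i, j). b i j) D \<noteq> 0" using bP by (simp add: meval_P)
      ultimately have "\<forall>m\<in>?J. Poly_Mapping.lookup F m = 0"
        using inj[rule_format, of "meval (\<lambda>(i, j). b i j)" "Poly_Mapping.lookup F"]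
          ring_hom_msubst[OF ring_hom_id] by blast
      then show "F = 0" using keys by (intro poly_mapping_eqI) (auto simp: in_keys_iff)
    qed
  qed
qed

lemma dim_zero_space: "mpoly.dim ({0} :: ('v, 'k :: field) mpoly set) = 0"
  using mpoly.dim_eq_card[of "{}" "{0}"] by (simp add: mpoly.independent_empty mpoly.span_insert_0)

theorem theorem3:
  fixes d r s \<delta> \<mu> :: nat
  assumes "2 \<le> d" and "2 \<le> s" and "r = s ^ d"
    and "(r, d) \<notin> {(4, 2), (9, 2), (8, 3)}"
    and "1 \<le> \<mu>" and "\<delta> \<le> s * \<mu>"
  shows "generic_dim TYPE('k :: {alg_closed_field, field_char_0}) d \<delta> \<mu> r = 0 \<and>
    for_general_points d r (\<lambda>p :: nat \<Rightarrow> (nat \<Rightarrow> 'k) set.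
      \<forall>F \<in> homogeneous_polys d \<delta>. (\<forall>i<r. vanishes_to_order d \<mu> (p i) F) \<longrightarrow> F = 0)"
proof -
  have s2: "d = 2 \<longrightarrow> 4 \<le> s"
  proof (rule impI, rule ccontr)
    assume "d = 2"
    assume "\<not> 4 \<le> s"
    then have "s = 2 \<or> s = 3" using assms(2) by linarith
    then show False using assms(3,4) \<open>d = 2\<close> by auto
  qed
  have s3: "d = 3 \<longrightarrow> 3 \<le> s"
  proof (rule impI, rule ccontr)
    assume "d = 3"
    assume "\<not> 3 \<le> s"
    then have "s = 2" using assms(2) by linarith
    then show False using assms(3,4) \<open>d = 3\<close> by auto
  qed
  obtain P :: "(nat \<times> nat, 'k) mpoly" and e a where P: "multihomogeneous d r e P"
    and a: "\<And>i j. d < j \<Longrightarrow> a i j = 0" "meval (\<lambda>(i, j). a i j) P \<noteq> 0"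
    and chart: "\<And>b i. meval (\<lambda>(i, j). b i j) P \<noteq> 0 \<Longrightarrow> i < r \<Longrightarrow> b i 0 \<noteq> 0"
    and zero: "\<And>b F. meval (\<lambda>(i, j). b i j) P \<noteq> 0 \<Longrightarrow> F \<in> homogeneous_polys d \<delta> \<Longrightarrow>
      \<forall>i<r. \<forall>m\<in>Poly_Mapping.keys (local_equation 0 (b i) F). \<mu> \<le> mdeg m \<Longrightarrow> F = 0"
    by (rule generic_vanishing_polynomial[OF assms(1,2) s2 s3 assms(5,6,3), where 'k='k]) blast
  let ?U = "nonvanishing_locus d r P"
  have U: "zariski_open d r ?U" by (rule zariski_open_nonvanishing_locus[OF P])
  have ai: "a i \<in> hom_coords d" if "i < r" for i
    using chart[OF a(2) that] a(1) by (auto simp: hom_coords_def)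
  have U_ne: "?U \<noteq> {}" using nonvanishing_locusI(1)[OF ai a(2)] by blast
  have U_zero: "F = 0" if p: "p \<in> ?U" and F: "F \<in> homogeneous_polys d \<delta>"
    and van: "\<forall>i<r. vanishes_to_order d \<mu> (p i) F" for p and F :: "(nat, 'k) mpoly"
  proof -
    obtain b where b: "\<And>i. i < r \<Longrightarrow> b i \<in> p i" "meval (\<lambda>(i, j). b i j) P \<noteq> 0"
      using p by (auto simp: nonvanishing_locus_def)
    show ?thesis
    proof (rule zero[OF b(2) F], intro allI impI ballI)
      fix i m assume i: "i < r" and m: "m \<in> Poly_Mapping.keys (local_equation 0 (b i) F)"
      have "vanishes_to_order d \<mu> (p i) F" using van i by blast
      then show "\<mu> \<le> mdeg m"
        using b(1)[OF i] chart[OF b(2) i] m le0 unfolding vanishes_to_order_def by blast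
    qed
  qed
  have dim: "mpoly.dim (fat_point_system d \<delta> \<mu> r p :: (nat, 'k) mpoly set) = 0" if "p \<in> ?U" for p
  proof -
    have "fat_point_system d \<delta> \<mu> r p = {0 :: (nat, 'k) mpoly}"
      using U_zero[OF that]
      by (auto simp: fat_point_system_def homogeneous_polys_def vanishes_to_order_def
          local_equation_def msubst_def)
    then show ?thesis by (simp add: dim_zero_space)
  qed
  have "generic_dim TYPE('k) d \<delta> \<mu> r = 0"
    unfolding generic_dim_def
  proof (rule the_equality)
    show "for_general_points d r (\<lambda>p. mpoly.dim (fat_point_system d \<delta> \<mu> r p :: (nat, 'k) mpoly set) = 0)"
      unfolding for_general_points_def using U U_ne dim by blast
    fix n assume "for_general_points d r (\<lambda>p. mpoly.dim (fat_point_system d \<delta> \<mu> r p :: (nat, 'k) mpoly set) = n)"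
    then obtain V where V: "zariski_open d r V" "V \<noteq> {}"
      "\<And>p. p \<in> V \<Longrightarrow> mpoly.dim (fat_point_system d \<delta> \<mu> r p :: (nat, 'k) mpoly set) = n"
      unfolding for_general_points_def by blast
    have "?U \<inter> V \<noteq> {}" using a chart V(1,2) by (intro nonvanishing_locus_meets_open[where a=a])
    then obtain p where "p \<in> ?U" "p \<in> V" by blast
    with dim V(3) show "n = 0" by force
  qed
  moreover have "for_general_points d r (\<lambda>p :: nat \<Rightarrow> (nat \<Rightarrow> 'k) set.
      \<forall>F \<in> homogeneous_polys d \<delta>. (\<forall>i<r. vanishes_to_order d \<mu> (p i) F) \<longrightarrow> F = 0)"
    unfolding for_general_points_def using U U_ne U_zero by blast
  ultimately show ?thesis by blast
qed

end
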